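(* Let $q$ be a prime power and $n\ge 2$. Then $$\delta^{\mathrm{rk}}_q(n\times n, 2, n) = \frac{s_q(n)\prod_{i=0}^{n-1}(q^n-q^i)}{(q^{n^2}-1)(q^{n^2}-q)}.$$ In particular, $$\lim_{q \to +\infty} \delta^{\mathrm{rk}}_q(n \times n, 2, n) = \sum_{i=0}^n \frac{(-1)^i}{i!}, \qquad \lim_{n \to +\infty} \delta^{\mathrm{rk}}_q(n \times n, 2, n) = \prod_{i=1}^{\infty} \left(1-\frac{1}{q^i}\right)^{q+1}.$$
   Context: $s_q(n)$ is the number of matrices $M\in\mathbb{F}_q^{n\times n}$ having no eigenvalue in $\mathbb{F}_q$. $\delta^{\mathrm{rk}}_q(n\times m,k,d)$ is the number of $k$-dimensional $\mathbb{F}_q$-linear subspaces of $\mathbb{F}_q^{n\times m}$ in which every nonzero matrix has rank at least $d$, divided by the number $\prod_{\ell=0}^{k-1}\frac{q^{mn}-q^\ell}{q^k-q^\ell}$ of all $k$-dimensional subspaces of $\mathbb{F}_q^{n\times m}$. The limit in $q$ is over prime powers with $n$ fixed; the limit in $n$ has $q$ fixed. *)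

theory Defs
  imports
    "HOL-Analysis.Infinite_Products"
    "HOL-Number_Theory.Prime_Powers"
    "Jordan_Normal_Form.Missing_VectorSpace"
begin

text \<open>
  A limit over all prime powers cannot range over field types, so fields are HOL-Algebra records.
  Every finite field is isomorphic to one whose carrier is a set of naturals, and a field with a
  prime power number of elements is unique up to isomorphism; all notions below are invariant under
  isomorphism, so the choice made here is immaterial.
\<close>

definition GF :: "nat \<Rightarrow> nat ring" where
  "GF q = (SOME F. field F \<and> finite (carrier F) \<and> card (carrier F) = q)"

text \<open>
  The library's space of extensional functions from an index set to the field serves both as the
  space of column vectors and as the space of matrices; the entry of \<open>A\<close> in row \<open>i\<close> and column
  \<open>j\<close> is \<open>A (i, j)\<close>, with indices starting at \<open>0\<close>.
\<close>

definition vec_sp :: "('a, 'b) ring_scheme \<Rightarrow> nat \<Rightarrow> ('a, nat \<Rightarrow> 'a) module" where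
  "vec_sp F n = ring.func_space F {..<n}"

definition mat_sp :: "('a, 'b) ring_scheme \<Rightarrow> nat \<Rightarrow> nat \<Rightarrow> ('a, nat \<times> nat \<Rightarrow> 'a) module" where
  "mat_sp F n m = ring.func_space F ({..<n} \<times> {..<m})"

definition mat_col :: "nat \<Rightarrow> (nat \<times> nat \<Rightarrow> 'a) \<Rightarrow> nat \<Rightarrow> (nat \<Rightarrow> 'a)" where
  "mat_col n A j = (\<lambda>i\<in>{..<n}. A (i, j))"

definition mat_rank :: "('a, 'b) ring_scheme \<Rightarrow> nat \<Rightarrow> nat \<Rightarrow> (nat \<times> nat \<Rightarrow> 'a) \<Rightarrow> nat" where
  "mat_rank F n m A =
     vectorspace.dim F
       ((vec_sp F n)\<lparr>carrier := LinearCombinations.module.span F (vec_sp F n) (mat_col n A ` {..<m})\<rparr>)"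

definition mat_vec ::
  "('a, 'b) ring_scheme \<Rightarrow> nat \<Rightarrow> nat \<Rightarrow> (nat \<times> nat \<Rightarrow> 'a) \<Rightarrow> (nat \<Rightarrow> 'a) \<Rightarrow> (nat \<Rightarrow> 'a)" where
  "mat_vec F n m A v = (\<lambda>i\<in>{..<n}. \<Oplus>\<^bsub>F\<^esub>j\<in>{..<m}. A (i, j) \<otimes>\<^bsub>F\<^esub> v j)"

definition mat_eigenvalue ::
  "('a, 'b) ring_scheme \<Rightarrow> nat \<Rightarrow> (nat \<times> nat \<Rightarrow> 'a) \<Rightarrow> 'a \<Rightarrow> bool" where
  "mat_eigenvalue F n A c \<longleftrightarrow>
     c \<in> carrier F \<and>
     (\<exists>v\<in>carrier (vec_sp F n). v \<noteq> \<zero>\<^bsub>vec_sp F n\<^esub> \<and> mat_vec F n n A v = c \<odot>\<^bsub>vec_sp F n\<^esub> v)"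

definition num_no_eigenvalue :: "nat \<Rightarrow> nat \<Rightarrow> nat" where
  "num_no_eigenvalue q n =
     card {A \<in> carrier (mat_sp (GF q) n n). \<not> (\<exists>c. mat_eigenvalue (GF q) n A c)}"

definition rk_codes ::
  "('a, 'b) ring_scheme \<Rightarrow> nat \<Rightarrow> nat \<Rightarrow> nat \<Rightarrow> nat \<Rightarrow> (nat \<times> nat \<Rightarrow> 'a) set set" where
  "rk_codes F n m k d =
     {C. subspace F C (mat_sp F n m) \<and>
         vectorspace.dim F ((mat_sp F n m)\<lparr>carrier := C\<rparr>) = k \<and>
         (\<forall>A\<in>C. A \<noteq> \<zero>\<^bsub>mat_sp F n m\<^esub> \<longrightarrow> mat_rank F n m A \<ge> d)}"

definition delta_rk :: "nat \<Rightarrow> nat \<Rightarrow> nat \<Rightarrow> nat \<Rightarrow> nat \<Rightarrow> real" where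
  "delta_rk q n m k d =
     real (card (rk_codes (GF q) n m k d)) /
     (\<Prod>l<k. (real q ^ (m * n) - real q ^ l) / (real q ^ k - real q ^ l))"

end

theory Submission
  imports
    Defs
    "HOL-Algebra.Algebraic_Closure"
    "HOL-Number_Theory.Residues"
    "HOL-Computational_Algebra.Formal_Power_Series"
    "HOL-Real_Asymp.Real_Asymp"
begin

text \<open>
  Choosing an ordered basis, a two-dimensional code of nonsingular matrices amounts to a pair
  \<open>(B, A)\<close> with \<open>A\<close> nonsingular and \<open>B - c A\<close> nonsingular for every scalar \<open>c\<close>.  For a fixed
  injective linear map \<open>T\<close>, the number of \<open>M\<close> such that no \<open>M - c T\<close> is singular does not depend on
  \<open>T\<close>.  Indeed, a space \<open>W\<close> of dimension at most \<open>n\<close> over the field with \<open>q\<close> elements satisfies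
  \<open>\<Sum>k\<le>n. b k * N k W = (if W = 0 then 1 else 0)\<close>, where \<open>N k W\<close> is the number of independent
  \<open>k\<close>-tuples in \<open>W\<close> and \<open>b k = (-1)^k / ((q - 1) \<dots> (q^k - 1))\<close>.  Applying this to
  \<open>W = ker (M - c T)\<close> for one scalar after the other reduces the count to that of the \<open>M\<close> with
  prescribed values on an independent tuple, because eigenvectors for distinct scalars are
  independent.  With \<open>B(u) = \<Sum> b k u^k\<close> and \<open>A(u) = \<Sum> q^(k\<^sup>2) / |GL k| u^k\<close> the result is that the
  number of matrices without eigenvalue is \<open>|GL n|\<close> times the coefficient of \<open>u^n\<close> in \<open>B^q A\<close>.

  Since \<open>B A = 1 / (1 - u)\<close>, this coefficient is the sum of the first \<open>n + 1\<close> coefficients of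
  \<open>B^(q - 1)\<close>.  For \<open>n \<rightarrow> \<infinity>\<close> it tends to \<open>B(1)^(q - 1)\<close> with \<open>B(1) = \<Prod>i\<ge>1. 1 - q^(-i)\<close>, and
  for \<open>q \<rightarrow> \<infinity>\<close> the differential equation satisfied by \<open>B^(q - 1)\<close> shows that its \<open>k\<close>-th
  coefficient tends to \<open>(-1)^k / k!\<close>.
\<close>

section \<open>Finite fields of prime power order\<close>

lemma (in cring) binomial_expansion:
  assumes x: "x \<in> carrier R" and y: "y \<in> carrier R"
  shows "(x \<oplus> y) [^] n = (\<Oplus>k\<in>{..n}. [(n choose k)] \<cdot> (x [^] k \<otimes> y [^] (n - k)))"
proof (induction n)
  case 0
  show ?case by (simp add: x y)
next
  case (Suc n)
  let ?t = "\<lambda>k. [(n choose k)] \<cdot> (x [^] k \<otimes> y [^] (n - k))"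
  \<comment> \<open>The products with x, shifted by one index and padded with zero, so that both
    sums range over {..Suc n} and Pascal's rule applies termwise.\<close>
  let ?f = "\<lambda>k. case k of 0 \<Rightarrow> \<zero> | Suc j \<Rightarrow> x \<otimes> ?t j"
  let ?g = "\<lambda>k. [(n choose k)] \<cdot> (x [^] k \<otimes> y [^] (Suc n - k))"
  have f: "?f \<in> A \<rightarrow> carrier R" for A using x y by (auto split: nat.splits)
  have g: "?g \<in> A \<rightarrow> carrier R" for A using x y by auto
  have "x \<otimes> (\<Oplus>k\<in>{..n}. ?t k) = (\<Oplus>k\<in>{..n}. x \<otimes> ?t k)"
    using x y by (intro finsum_rdistr) auto
  also have "\<dots> = (\<Oplus>k\<in>{..Suc n}. ?f k)"
    using finsum_Suc2[OF f, of n] x y by simp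
  finally have 1: "x \<otimes> (\<Oplus>k\<in>{..n}. ?t k) = (\<Oplus>k\<in>{..Suc n}. ?f k)" .
  have "y \<otimes> (\<Oplus>k\<in>{..n}. ?t k) = (\<Oplus>k\<in>{..n}. y \<otimes> ?t k)"
    using x y by (intro finsum_rdistr) auto
  also have "\<dots> = (\<Oplus>k\<in>{..n}. ?g k)"
  proof (rule finsum_cong')
    fix k assume k: "k \<in> {..n}"
    hence e: "Suc n - k = Suc (n - k)" by auto
    have "y \<otimes> (x [^] k \<otimes> y [^] (n - k)) = x [^] k \<otimes> y [^] (Suc n - k)"
      unfolding e using x y by (simp add: m_ac)
    thus "y \<otimes> ?t k = ?g k" using x y by (simp add: add_pow_rdistr)
  qed (use g in auto)
  also have "\<dots> = (\<Oplus>k\<in>{..Suc n}. ?g k)"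
    using finsum_Suc[OF g, of n] x y by (simp add: finsum_closed[OF g] binomial_eq_0)
  finally have 2: "y \<otimes> (\<Oplus>k\<in>{..n}. ?t k) = (\<Oplus>k\<in>{..Suc n}. ?g k)" .
  have t: "(\<Oplus>k\<in>{..n}. ?t k) \<in> carrier R" using x y by (intro finsum_closed) auto
  have distr: "S \<otimes> (x \<oplus> y) = x \<otimes> S \<oplus> y \<otimes> S" if "S \<in> carrier R" for S
    using x y that by (simp add: r_distr m_comm)
  have "(x \<oplus> y) [^] Suc n = x \<otimes> (\<Oplus>k\<in>{..n}. ?t k) \<oplus> y \<otimes> (\<Oplus>k\<in>{..n}. ?t k)"
    unfolding nat_pow_Suc Suc.IH by (rule distr[OF t])
  also have "\<dots> = (\<Oplus>k\<in>{..Suc n}. ?f k \<oplus> ?g k)"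
    unfolding 1 2 by (rule finsum_addf[symmetric, OF f g])
  also have "\<dots> = (\<Oplus>k\<in>{..Suc n}. [(Suc n choose k)] \<cdot> (x [^] k \<otimes> y [^] (Suc n - k)))"
  proof (rule finsum_cong')
    fix k assume k: "k \<in> {..Suc n}"
    show "?f k \<oplus> ?g k = [(Suc n choose k)] \<cdot> (x [^] k \<otimes> y [^] (Suc n - k))"
    proof (cases k)
      case 0
      thus ?thesis using x y by simp
    next
      case (Suc j)
      have "x \<otimes> (x [^] j \<otimes> y [^] (n - j)) = x [^] Suc j \<otimes> y [^] (n - j)" using x y by (simp add: m_ac)
      thus ?thesis using x y Suc by (simp add: add_pow_rdistr add.nat_pow_mult)
    qed
  qed (use x y in auto)
  finally show ?case .
qed

lemma (in cring) add_pow_multiple_zero: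
  assumes "[p] \<cdot> \<one> = \<zero>" "p dvd (m::nat)" "x \<in> carrier R"
  shows "[m] \<cdot> x = \<zero>"
proof -
  obtain k where k: "m = p * k" using assms(2) by (elim dvdE)
  have "[m] \<cdot> \<one> = [k] \<cdot> ([p] \<cdot> \<one>)" unfolding k by (rule add.nat_pow_pow[symmetric]) simp
  hence "[m] \<cdot> \<one> = \<zero>" using assms(1) by simp
  thus ?thesis using add_pow_ldistr[of \<one> x m] assms(3) by simp
qed

text \<open>The coefficients \<open>p choose k\<close> with 0 < k < p are multiples of p and vanish
  in the ring; powers of p follow by iteration.\<close>

lemma (in cring) frobenius_add:
  assumes p: "Factorial_Ring.prime (p::nat)" "[p] \<cdot> \<one> = \<zero>" and x: "x \<in> carrier R" and y: "y \<in> carrier R"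
  shows "(x \<oplus> y) [^] (p ^ k) = x [^] (p ^ k) \<oplus> y [^] (p ^ k)"
proof (induction k)
  case 0
  show ?case using x y by simp
next
  case (Suc k)
  have *: "(u \<oplus> v) [^] p = u [^] p \<oplus> v [^] p" if u: "u \<in> carrier R" and v: "v \<in> carrier R" for u v
  proof -
    obtain m where m: "p = Suc m" using p(1) by (cases p) auto
    let ?t = "\<lambda>k. [(p choose k)] \<cdot> (u [^] k \<otimes> v [^] (p - k))"
    have cl: "?t \<in> A \<rightarrow> carrier R" for A using u v by auto
    have z: "?t k = \<zero>" if "0 < k" "k < p" for k
      using u v that p by (intro add_pow_multiple_zero[OF p(2)] dvd_choose_prime) auto
    have "(u \<oplus> v) [^] p = (\<Oplus>k\<in>{..Suc m}. ?t k)" using binomial_expansion[OF u v, of p] m by simp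
    also have "\<dots> = ?t (Suc m) \<oplus> (\<Oplus>k\<in>{..m}. ?t k)" by (rule finsum_Suc[OF cl])
    also have "(\<Oplus>k\<in>{..m}. ?t k) = (\<Oplus>k\<in>{..m}. if 0 = k then ?t k else \<zero>)"
      using z m cl u v by (intro finsum_cong') (auto simp: less_Suc_eq_le)
    also have "\<dots> = ?t 0" using cl by (intro finsum_singleton) auto
    finally show ?thesis using u v m by simp
  qed
  have "(x \<oplus> y) [^] (p ^ Suc k) = ((x \<oplus> y) [^] (p ^ k)) [^] p"
    using x y by (simp add: nat_pow_pow mult.commute)
  also have "\<dots> = (x [^] (p ^ k)) [^] p \<oplus> (y [^] (p ^ k)) [^] p" unfolding Suc.IH using x y by (intro *) auto
  also have "\<dots> = x [^] (p ^ Suc k) \<oplus> y [^] (p ^ Suc k)" using x y by (simp add: nat_pow_pow mult.commute)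
  finally show ?case .
qed

section \<open>Fixed points of the Frobenius map in an algebraically closed field\<close>

lemma ring_hom_add_pow_one:
  assumes "h \<in> ring_hom R S" "ring R" "ring S"
  shows "h ([n] \<cdot>\<^bsub>R\<^esub> \<one>\<^bsub>R\<^esub>) = [(n::nat)] \<cdot>\<^bsub>S\<^esub> \<one>\<^bsub>S\<^esub>"
proof -
  interpret R: ring R by fact
  interpret S: ring S by fact
  interpret ring_hom_ring R S h using assms by (simp add: ring_hom_ringI2)
  show ?thesis by (induction n) auto
qed

lemma ring_hom_nat_pow:
  assumes "h \<in> ring_hom R S" "ring R" "ring S" "x \<in> carrier R"
  shows "h (x [^]\<^bsub>R\<^esub> (n::nat)) = h x [^]\<^bsub>S\<^esub> n"
proof -
  interpret R: ring R by fact
  interpret S: ring S by fact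
  interpret ring_hom_ring R S h using assms by (simp add: ring_hom_ringI2)
  show ?thesis using assms(4) by (induction n) auto
qed

lemma (in field) frobenius_fixed_subfield:
  assumes p: "Factorial_Ring.prime (p::nat)" "[p] \<cdot> \<one> = \<zero>"
  shows "subfield {x \<in> carrier R. x [^] (p ^ k) = x} R"
proof (rule subfieldI')
  let ?q = "p ^ k" and ?K = "{x \<in> carrier R. x [^] (p ^ k) = x}"
  have q: "?q > 0" using p(1) prime_gt_0_nat by simp
  show "subring ?K R"
  proof (rule subringI)
    fix h assume h: "h \<in> ?K"
    \<comment> \<open>Additivity of the power map identifies the power of -h without a case
      distinction on the parity of p.\<close>
    have "\<zero> = (h \<oplus> \<ominus> h) [^] ?q" using h q by (simp add: r_neg nat_pow_zero)
    also have "\<dots> = h \<oplus> (\<ominus> h) [^] ?q" using frobenius_add[OF p, of h "\<ominus> h" k] h by simp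
    finally have "(\<ominus> h) [^] ?q = \<ominus> h"
      using h by (metis (no_types, lifting) a_comm a_inv_closed mem_Collect_eq minus_equality nat_pow_closed)
    thus "\<ominus> h \<in> ?K" using h by simp
  qed (auto simp: nat_pow_distrib frobenius_add[OF p])
  fix x assume x: "x \<in> ?K - {\<zero>}"
  hence u: "x \<in> Units R" using field_Units by auto
  have "x \<otimes> (inv x) [^] ?q = x [^] ?q \<otimes> (inv x) [^] ?q" using x by simp
  also have "\<dots> = (x \<otimes> inv x) [^] ?q" using u by (intro nat_pow_distrib[symmetric]) auto
  also have "\<dots> = \<one>" using u by simp
  finally have "inv x = (inv x) [^] ?q" using u x by (intro comm_inv_char) auto
  thus "inv x \<in> ?K" using u by simp
qed

text \<open>The fixed points are the roots of X^q - X with q = p^k. This polynomial splits and has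
  only simple roots, so their number is its degree.\<close>

lemma (in algebraically_closed) card_frobenius_fixed:
  assumes p: "Factorial_Ring.prime (p::nat)" "[p] \<cdot> \<one> = \<zero>" and k: "k > 0"
  shows "finite {x \<in> carrier L. x [^] (p ^ k) = x} \<and> card {x \<in> carrier L. x [^] (p ^ k) = x} = p ^ k"
proof -
  let ?q = "p ^ k" and ?K = "{x \<in> carrier L. x [^] (p ^ k) = x}" and ?P = "poly_ring L"
  have q: "?q \<ge> 2" using p(1) k prime_ge_2_nat[OF p(1)] self_le_power[of p k] by linarith
  interpret UP: domain ?P by (rule univ_poly_is_domain[OF carrier_is_subring])
  have X: "X \<in> carrier ?P" by (rule var_closed(1)[OF carrier_is_subring])
  define f where "f = X [^]\<^bsub>?P\<^esub> ?q \<ominus>\<^bsub>?P\<^esub> X"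
  have f: "f \<in> carrier ?P" unfolding f_def using X by simp
  have degf: "degree f = ?q"
  proof -
    have Xq: "X [^]\<^bsub>?P\<^esub> ?q = monom \<one> ?q" by (rule unitary_monom_eq_var_pow[OF carrier_is_subring, symmetric])
    have d1: "degree (X [^]\<^bsub>?P\<^esub> ?q) = ?q" unfolding Xq by (simp add: monom_def)
    have d2: "degree (\<ominus>\<^bsub>?P\<^esub> X) = 1"
      using univ_poly_a_inv_def'[OF carrier_is_subring X] by (simp add: var_def)
    \<comment> \<open>The degrees \<open>?q\<close> and 1 differ because \<open>?q\<close> is at
      least 2, so the leading term survives.\<close>
    have "degree (poly_add (X [^]\<^bsub>?P\<^esub> ?q) (\<ominus>\<^bsub>?P\<^esub> X)) = max ?q 1"
      using poly_add_degree_eq[OF carrier_is_subring, of "X [^]\<^bsub>?P\<^esub> ?q" "\<ominus>\<^bsub>?P\<^esub> X"]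
        UP.a_inv_closed[OF X] UP.nat_pow_closed[OF X, of ?q] q
      unfolding d1 d2 univ_poly_carrier by linarith
    thus ?thesis using q by (simp add: f_def a_minus_def univ_poly_add)
  qed
  have evalf: "eval f a = a [^] ?q \<ominus> a" if a: "a \<in> carrier L" for a
  proof -
    have hom: "(\<lambda>p. eval p a) \<in> ring_hom ?P L" by (rule eval_is_hom[OF carrier_is_subring a])
    interpret ev: ring_hom_ring ?P L "\<lambda>p. eval p a"
      using hom by (intro ring_hom_ringI2) (unfold_locales)
    show ?thesis
      unfolding f_def a_minus_def using X a
      by (simp add: ring_hom_nat_pow[OF hom UP.ring_axioms ring_axioms X] eval_var)
  qed
  have "f \<noteq> []" using degf q k by (cases k) auto
  moreover have "eval f a = \<zero> \<longleftrightarrow> a [^] ?q = a" if "a \<in> carrier L" for a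
    using that by (simp only: evalf r_right_minus_eq nat_pow_closed)
  ultimately have root: "is_root f a \<longleftrightarrow> a \<in> ?K" for a by (auto simp: is_root_def)
  \<comment> \<open>The roots are simple because \<open>f = (X - a)^q - (X - a)\<close> for every root \<open>a\<close>.\<close>
  have mult: "alg_mult f a = 1" if a: "a \<in> ?K" for a
  proof (rule ccontr)
    assume "alg_mult f a \<noteq> 1"
    moreover have "alg_mult f a > 0" using alg_mult_gt_zero_iff_is_root[OF f] root a by simp
    ultimately have two: "2 \<le> alg_mult f a" by linarith
    have aL: "a \<in> carrier L" using a by simp
    let ?D = "[\<one>, \<ominus> a]"
    have D: "?D \<in> carrier ?P" using aL by (simp add: univ_poly_carrier[symmetric] polynomial_def)
    from le_alg_mult_imp_pdivides[OF aL f two]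
    have "(?D [^]\<^bsub>?P\<^esub> (2::nat)) divides\<^bsub>?P\<^esub> f" by (simp add: pdivides_def)
    then obtain h where h: "h \<in> carrier ?P" "f = ?D [^]\<^bsub>?P\<^esub> (2::nat) \<otimes>\<^bsub>?P\<^esub> h" by (auto simp: factor_def)
    have hom: "poly_of_const \<in> ring_hom L ?P" using canonical_embedding_is_hom[OF carrier_is_subring] by simp
    define c where "c = poly_of_const a"
    have c: "c \<in> carrier ?P" unfolding c_def using ring_hom_closed[OF hom aL] .
    have cq: "c [^]\<^bsub>?P\<^esub> ?q = c"
      unfolding c_def using ring_hom_nat_pow[OF hom ring_axioms UP.ring_axioms aL, of ?q] a by simp
    have XD: "X = ?D \<oplus>\<^bsub>?P\<^esub> c"
      using aL by (auto simp: c_def poly_of_const_def var_def univ_poly_add l_neg)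
    have "poly_of_const ([p] \<cdot> \<one>) = [p] \<cdot>\<^bsub>?P\<^esub> \<one>\<^bsub>?P\<^esub>"
      by (rule ring_hom_add_pow_one[OF hom ring_axioms UP.ring_axioms])
    hence pP: "[p] \<cdot>\<^bsub>?P\<^esub> \<one>\<^bsub>?P\<^esub> = \<zero>\<^bsub>?P\<^esub>" using p(2) by (simp add: poly_of_const_def univ_poly_zero)
    have "X [^]\<^bsub>?P\<^esub> ?q = ?D [^]\<^bsub>?P\<^esub> ?q \<oplus>\<^bsub>?P\<^esub> c"
      using UP.frobenius_add[OF p(1) pP D c, of k] cq XD by simp
    hence "f = (?D [^]\<^bsub>?P\<^esub> ?q \<oplus>\<^bsub>?P\<^esub> c) \<ominus>\<^bsub>?P\<^esub> (?D \<oplus>\<^bsub>?P\<^esub> c)" unfolding f_def using XD by simp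
    also have "\<dots> = ?D [^]\<^bsub>?P\<^esub> ?q \<ominus>\<^bsub>?P\<^esub> ?D" using D c UP.nat_pow_closed[OF D, of ?q] by algebra
    also have "?D [^]\<^bsub>?P\<^esub> ?q = ?D \<otimes>\<^bsub>?P\<^esub> (?D [^]\<^bsub>?P\<^esub> (?q - 1))"
    proof -
      have "Suc (?q - 1) = ?q" using q by simp
      thus ?thesis using UP.nat_pow_Suc2[OF D, of "?q - 1"] by (simp only:)
    qed
    finally have fD: "f = ?D \<otimes>\<^bsub>?P\<^esub> (?D [^]\<^bsub>?P\<^esub> (?q - 1) \<ominus>\<^bsub>?P\<^esub> \<one>\<^bsub>?P\<^esub>)"
      using D UP.nat_pow_closed[OF D, of "?q - 1"] by (simp add: UP.r_distr UP.r_minus a_minus_def)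
    \<comment> \<open>If a were a double root, \<open>?D\<close> would divide ?D^(q - 1) - 1, whose
      value at a is -1.\<close>
    have "?D \<otimes>\<^bsub>?P\<^esub> (?D [^]\<^bsub>?P\<^esub> (?q - 1) \<ominus>\<^bsub>?P\<^esub> \<one>\<^bsub>?P\<^esub>) = ?D \<otimes>\<^bsub>?P\<^esub> (?D \<otimes>\<^bsub>?P\<^esub> h)"
      using fD h D by (simp add: numeral_2_eq_2 UP.m_assoc)
    hence eq: "?D [^]\<^bsub>?P\<^esub> (?q - 1) \<ominus>\<^bsub>?P\<^esub> \<one>\<^bsub>?P\<^esub> = ?D \<otimes>\<^bsub>?P\<^esub> h"
      using D h UP.m_lcancel[of ?D] by (simp add: univ_poly_zero)
    have hom: "(\<lambda>p. eval p a) \<in> ring_hom ?P L" by (rule eval_is_hom[OF carrier_is_subring aL])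
    interpret ev: ring_hom_ring ?P L "\<lambda>p. eval p a"
      using hom by (intro ring_hom_ringI2) (unfold_locales)
    have ev0: "eval ?D a = \<zero>" using aL by (simp add: r_neg)
    have "eval (?D [^]\<^bsub>?P\<^esub> (?q - 1)) a = \<zero>"
      using ring_hom_nat_pow[OF hom UP.ring_axioms ring_axioms D, of "?q - 1"] ev0 q by (simp add: nat_pow_zero)
    hence "eval (?D [^]\<^bsub>?P\<^esub> (?q - 1) \<ominus>\<^bsub>?P\<^esub> \<one>\<^bsub>?P\<^esub>) a = \<ominus> \<one>"
      unfolding a_minus_def using D by simp
    moreover have "eval (?D \<otimes>\<^bsub>?P\<^esub> h) a = \<zero>" using D h ev0 by simp
    ultimately have "\<ominus> \<one> = \<zero>" using eq by simp
    thus False by simp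
  qed
  have set: "set_mset (roots f) = ?K" using roots_mem_iff_is_root[OF f] root by auto
  have "?q = size (roots f)" using roots_over_carrier[OF f] degf by (simp add: splitted_def)
  also have "\<dots> = (\<Sum>a\<in>?K. count (roots f) a)" by (simp add: size_multiset_overloaded_eq set)
  also have "\<dots> = card ?K" using mult alg_mult_eq_count_roots[OF f] by simp
  finally show ?thesis using set finite_set_mset[of "roots f"] by simp
qed

text \<open>The field consists of the roots of X^q - X in an algebraic closure of the integers
  modulo p.\<close>

lemma finite_field_exists:
  assumes "primepow q"
  shows "\<exists>F :: nat ring. field F \<and> finite (carrier F) \<and> card (carrier F) = q"
proof -
  obtain p k where pk: "Factorial_Ring.prime (p::nat)" "k > 0" "q = p ^ k" using assms by (auto simp: primepow_def)
  interpret R: residues_prime p "residue_ring (int p)" using pk by unfold_locales auto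
  obtain L :: "((int list \<times> nat) multiset \<Rightarrow> int) ring"
    where L: "algebraic_closure L (R.indexed_const ` carrier (residue_ring (int p)))"
      and hom: "R.indexed_const \<in> ring_hom (residue_ring (int p)) L"
    using R.exists_closure .
  interpret L: algebraic_closure L "R.indexed_const ` carrier (residue_ring (int p))" by (rule L)
  \<comment> \<open>Lagrange's theorem in the additive group of order p.\<close>
  have "[card (carrier (residue_ring (int p)))] \<cdot>\<^bsub>residue_ring (int p)\<^esub> \<one>\<^bsub>residue_ring (int p)\<^esub> = \<zero>\<^bsub>residue_ring (int p)\<^esub>"
    using R.add.pow_order_eq_1[of "\<one>\<^bsub>residue_ring (int p)\<^esub>"] by (simp add: order_def)
  moreover have "card (carrier (residue_ring (int p))) = p" by (simp add: R.res_carrier_eq)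
  ultimately have p0: "[p] \<cdot>\<^bsub>residue_ring (int p)\<^esub> \<one>\<^bsub>residue_ring (int p)\<^esub> = \<zero>\<^bsub>residue_ring (int p)\<^esub>" by simp
  have "[p] \<cdot>\<^bsub>L\<^esub> \<one>\<^bsub>L\<^esub> = R.indexed_const \<zero>\<^bsub>residue_ring (int p)\<^esub>"
    using ring_hom_add_pow_one[OF hom R.ring_axioms L.ring_axioms, of p] p0 by simp
  also have "\<dots> = \<zero>\<^bsub>L\<^esub>" using ring_hom_zero[OF hom R.ring_axioms L.ring_axioms] .
  finally have pL: "[p] \<cdot>\<^bsub>L\<^esub> \<one>\<^bsub>L\<^esub> = \<zero>\<^bsub>L\<^esub>" .
  define K where "K = {x \<in> carrier L. x [^]\<^bsub>L\<^esub> (p ^ k) = x}"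
  have K: "finite K" "card K = q"
    using L.card_frobenius_fixed[OF pk(1) pL pk(2)] pk by (auto simp: K_def)
  have "subfield K L" unfolding K_def by (rule L.frobenius_fixed_subfield[OF pk(1) pL])
  then interpret K: field "L\<lparr>carrier := K\<rparr>" by (rule L.subfield_iff(2))
  \<comment> \<open>Renaming the elements along an injection moves the field to the record type over
    the naturals from which \<open>GF\<close> chooses.\<close>
  obtain f :: "_ \<Rightarrow> nat" where f: "inj_on f K" using finite_imp_inj_to_nat_seg[OF K(1)] by metis
  have "field (image_ring f (L\<lparr>carrier := K\<rparr>))" using f by (intro K.inj_imp_image_ring_is_field) simp
  moreover have "carrier (image_ring f (L\<lparr>carrier := K\<rparr>)) = f ` K" by (simp add: image_ring_carrier)
  ultimately show ?thesis using K f by (intro exI[of _ "image_ring f (L\<lparr>carrier := K\<rparr>)"]) (simp add: card_image)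
qed

lemma GF_finite_field:
  assumes "primepow q"
  shows "field (GF q)" "finite (carrier (GF q))" "card (carrier (GF q)) = q"
  using someI_ex[OF finite_field_exists[OF assms]] unfolding GF_def by auto

section \<open>Independent lists of vectors\<close>

locale finite_vectorspace = vectorspace K V for K and V +
  assumes finite_scalars: "finite (carrier K)"
    and finite_vectors: "finite (carrier V)"
begin

text \<open>Recursion on the list, instead of linear combinations over a set, lets spans be compared
  and counted one vector at a time.\<close>

primrec list_span :: "'c list \<Rightarrow> 'c set" where
  "list_span [] = {\<zero>\<^bsub>V\<^esub>}"
| "list_span (x # xs) = {c \<odot>\<^bsub>V\<^esub> x \<oplus>\<^bsub>V\<^esub> w | c w. c \<in> carrier K \<and> w \<in> list_span xs}"

text \<open>These are ordered independent tuples; a repeated entry lies in the span of its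
  successors and is thereby excluded.\<close>

primrec list_indpt :: "'c list \<Rightarrow> bool" where
  "list_indpt [] \<longleftrightarrow> True"
| "list_indpt (x # xs) \<longleftrightarrow> x \<in> carrier V \<and> x \<notin> list_span xs \<and> list_indpt xs"

lemma list_indpt_carrier: "list_indpt xs \<Longrightarrow> set xs \<subseteq> carrier V"
  by (induction xs) auto

lemma submodule_neg_closed:
  assumes "submodule K W V" "w \<in> W"
  shows "\<ominus>\<^bsub>V\<^esub> w \<in> W"
proof -
  have "\<ominus>\<^bsub>V\<^esub> w = (\<ominus>\<^bsub>K\<^esub> \<one>\<^bsub>K\<^esub>) \<odot>\<^bsub>V\<^esub> w"
    using assms submodule.subset smult_minus_1 by (metis subsetD)
  thus ?thesis
    using assms by (simp add: submodule.smult_closed)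
qed

lemma list_span_submodule:
  assumes "set xs \<subseteq> carrier V"
  shows "submodule K (list_span xs) V"
  using assms
proof (induction xs)
  case Nil
  show ?case by unfold_locales auto
next
  case (Cons x xs)
  interpret S: submodule K "list_span xs" V using Cons by auto
  have x: "x \<in> carrier V" using Cons by auto
  show ?case
  proof
    show "list_span (x # xs) \<subseteq> carrier V"
      using x S.subset by auto
  next
    fix v w assume "v \<in> list_span (x # xs)" "w \<in> list_span (x # xs)"
    then obtain c s d t where *: "c \<in> carrier K" "d \<in> carrier K" "s \<in> list_span xs" "t \<in> list_span xs"
      "v = c \<odot>\<^bsub>V\<^esub> x \<oplus>\<^bsub>V\<^esub> s" "w = d \<odot>\<^bsub>V\<^esub> x \<oplus>\<^bsub>V\<^esub> t" by auto
    have "s \<in> carrier V" "t \<in> carrier V" using * S.subset by auto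
    hence "v \<oplus>\<^bsub>V\<^esub> w = (c \<oplus>\<^bsub>K\<^esub> d) \<odot>\<^bsub>V\<^esub> x \<oplus>\<^bsub>V\<^esub> (s \<oplus>\<^bsub>V\<^esub> t)"
      using * x by (simp add: smult_l_distr M.a_ac)
    thus "v \<oplus>\<^bsub>V\<^esub> w \<in> list_span (x # xs)" using * by force
  next
    have "\<zero>\<^bsub>V\<^esub> = \<zero>\<^bsub>K\<^esub> \<odot>\<^bsub>V\<^esub> x \<oplus>\<^bsub>V\<^esub> \<zero>\<^bsub>V\<^esub>" using x by simp
    thus "\<zero>\<^bsub>V\<^esub> \<in> list_span (x # xs)" by force
  next
    fix d v assume d: "d \<in> carrier K" and "v \<in> list_span (x # xs)"
    then obtain c s where *: "c \<in> carrier K" "s \<in> list_span xs" "v = c \<odot>\<^bsub>V\<^esub> x \<oplus>\<^bsub>V\<^esub> s" by auto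
    have "s \<in> carrier V" using * S.subset by auto
    hence "d \<odot>\<^bsub>V\<^esub> v = (d \<otimes>\<^bsub>K\<^esub> c) \<odot>\<^bsub>V\<^esub> x \<oplus>\<^bsub>V\<^esub> d \<odot>\<^bsub>V\<^esub> s"
      using * d x by (simp add: smult_r_distr smult_assoc1)
    thus "d \<odot>\<^bsub>V\<^esub> v \<in> list_span (x # xs)" using * d by force
  qed
qed

lemma list_span_carrier: "set xs \<subseteq> carrier V \<Longrightarrow> list_span xs \<subseteq> carrier V"
  using list_span_submodule submodule.subset by blast

lemma list_span_least:
  assumes "submodule K W V" "set xs \<subseteq> W"
  shows "list_span xs \<subseteq> W"
  using assms(2)
proof (induction xs)
  case Nil
  thus ?case using assms(1) by (simp add: submodule.zero_closed)
next
  case (Cons x xs)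
  thus ?case
    using assms(1) by (auto intro!: submodule.m_closed[OF assms(1)] submodule.smult_closed[OF assms(1)])
qed

lemma set_subset_list_span:
  assumes "set xs \<subseteq> carrier V"
  shows "set xs \<subseteq> list_span xs"
  using assms
proof (induction xs)
  case (Cons x xs)
  have x: "x \<in> carrier V" using Cons by auto
  interpret S: submodule K "list_span xs" V using Cons by (intro list_span_submodule) auto
  have "x = \<one>\<^bsub>K\<^esub> \<odot>\<^bsub>V\<^esub> x \<oplus>\<^bsub>V\<^esub> \<zero>\<^bsub>V\<^esub>" using x by simp
  hence "x \<in> list_span (x # xs)" using S.zero_closed by force
  moreover have "list_span xs \<subseteq> list_span (x # xs)"
  proof
    fix w assume w: "w \<in> list_span xs"
    hence "w = \<zero>\<^bsub>K\<^esub> \<odot>\<^bsub>V\<^esub> x \<oplus>\<^bsub>V\<^esub> w" using x S.subset by auto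
    thus "w \<in> list_span (x # xs)" using w by force
  qed
  ultimately show ?case using Cons by auto
qed simp

lemma smult_in_submodule_iff:
  assumes "submodule K W V" "x \<in> carrier V" "c \<in> carrier K" "c \<noteq> \<zero>\<^bsub>K\<^esub>"
  shows "c \<odot>\<^bsub>V\<^esub> x \<in> W \<longleftrightarrow> x \<in> W"
proof
  assume *: "c \<odot>\<^bsub>V\<^esub> x \<in> W"
  have c: "c \<in> Units K" using assms field_Units by auto
  have "x = (inv\<^bsub>K\<^esub> c \<otimes>\<^bsub>K\<^esub> c) \<odot>\<^bsub>V\<^esub> x" using c assms by simp
  also have "\<dots> = inv\<^bsub>K\<^esub> c \<odot>\<^bsub>V\<^esub> (c \<odot>\<^bsub>V\<^esub> x)" using c assms by (intro smult_assoc1) auto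
  finally show "x \<in> W" using * c assms(1) by (metis Units_inv_closed submodule.smult_closed)
qed (use assms in \<open>auto intro: submodule.smult_closed\<close>)

text \<open>A nonzero c could be divided out, which would place x itself in W.\<close>

lemma indpt_coeff_zero:
  assumes W: "submodule K W V" and x: "x \<in> carrier V" "x \<notin> W"
    and c: "c \<in> carrier K" and w: "w \<in> W" and eq: "c \<odot>\<^bsub>V\<^esub> x \<oplus>\<^bsub>V\<^esub> w \<in> W"
  shows "c = \<zero>\<^bsub>K\<^esub>"
proof (rule ccontr)
  assume "c \<noteq> \<zero>\<^bsub>K\<^esub>"
  have wV: "w \<in> carrier V" using w W submodule.subset by blast
  have "c \<odot>\<^bsub>V\<^esub> x = (c \<odot>\<^bsub>V\<^esub> x \<oplus>\<^bsub>V\<^esub> w) \<oplus>\<^bsub>V\<^esub> \<ominus>\<^bsub>V\<^esub> w"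
    using wV x c by (simp add: M.a_assoc M.r_neg)
  also have "\<dots> \<in> W" using W w eq submodule_neg_closed by (auto intro: submodule.m_closed)
  finally show False using smult_in_submodule_iff[OF W x(1) c \<open>c \<noteq> _\<close>] x by auto
qed

text \<open>Uniqueness of coordinates: this is why each new independent vector multiplies the size
  of the span by the number of scalars.\<close>

lemma list_span_inj:
  assumes x: "x \<in> carrier V" "x \<notin> list_span xs" and xs: "set xs \<subseteq> carrier V"
  shows "inj_on (\<lambda>(c, w). c \<odot>\<^bsub>V\<^esub> x \<oplus>\<^bsub>V\<^esub> w) (carrier K \<times> list_span xs)"
proof (rule inj_onI, clarify)
  fix c s d t assume *: "c \<in> carrier K" "s \<in> list_span xs" "d \<in> carrier K" "t \<in> list_span xs"
    and eq: "c \<odot>\<^bsub>V\<^esub> x \<oplus>\<^bsub>V\<^esub> s = d \<odot>\<^bsub>V\<^esub> x \<oplus>\<^bsub>V\<^esub> t"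
  note S = list_span_submodule[OF xs]
  have st: "s \<in> carrier V" "t \<in> carrier V" using * list_span_carrier[OF xs] by auto
  have "(c \<ominus>\<^bsub>K\<^esub> d) \<odot>\<^bsub>V\<^esub> x \<oplus>\<^bsub>V\<^esub> s = \<ominus>\<^bsub>V\<^esub> (d \<odot>\<^bsub>V\<^esub> x) \<oplus>\<^bsub>V\<^esub> (c \<odot>\<^bsub>V\<^esub> x \<oplus>\<^bsub>V\<^esub> s)"
    using * st x by (simp add: smult_l_distr smult_l_minus a_minus_def M.a_ac)
  also have "\<dots> = t" unfolding eq using * st x by (simp add: M.a_assoc[symmetric] M.l_neg)
  finally have "c \<ominus>\<^bsub>K\<^esub> d = \<zero>\<^bsub>K\<^esub>"
    using indpt_coeff_zero[OF S x, of "c \<ominus>\<^bsub>K\<^esub> d" s] * by auto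
  hence "c = d" using * by simp
  thus "c = d \<and> s = t" using eq st x * by auto
qed

lemma card_list_span:
  "list_indpt xs \<Longrightarrow> card (list_span xs) = card (carrier K) ^ length xs"
proof (induction xs)
  case (Cons x xs)
  have "list_span (x # xs) = (\<lambda>(c, w). c \<odot>\<^bsub>V\<^esub> x \<oplus>\<^bsub>V\<^esub> w) ` (carrier K \<times> list_span xs)"
    by auto
  thus ?case
    using Cons list_span_inj[of x xs] list_indpt_carrier[of xs]
    by (simp only:) (auto simp: card_image card_cartesian_product)
qed simp

text \<open>Serves to join eigenvectors for a new scalar to those already prescribed.\<close>

lemma list_indpt_append:
  assumes "list_indpt ys" "list_indpt xs" "list_span ys \<inter> list_span xs \<subseteq> {\<zero>\<^bsub>V\<^esub>}"
  shows "list_indpt (ys @ xs)"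
proof -
  have V: "set xs \<subseteq> carrier V" "set ys \<subseteq> carrier V" using assms list_indpt_carrier by auto
  \<comment> \<open>The bound on the joint span is carried through the induction because it turns a
    dependence of y into a relation y = u + w.\<close>
  have "list_indpt (ys @ xs) \<and> list_span (ys @ xs) \<subseteq> {u \<oplus>\<^bsub>V\<^esub> w | u w. u \<in> list_span ys \<and> w \<in> list_span xs}"
    using assms(1,3) V(2)
  proof (induction ys)
    case Nil
    have "w = \<zero>\<^bsub>V\<^esub> \<oplus>\<^bsub>V\<^esub> w" if "w \<in> list_span xs" for w
      using that list_span_carrier[OF V(1)] by auto
    thus ?case using assms(2) by fastforce
  next
    case (Cons y ys)
    have S: "submodule K (list_span ys) V" "submodule K (list_span xs) V"
        "submodule K (list_span (y # ys)) V"
      using Cons V by (auto intro!: list_span_submodule simp del: list_span.simps)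
    have y: "y \<in> carrier V" using Cons by auto
    have sub: "list_span ys \<subseteq> list_span (y # ys)"
      using list_span_least[OF S(3), of ys] set_subset_list_span[of "y # ys"] Cons.prems
      by (auto simp del: list_span.simps)
    have yin: "y \<in> list_span (y # ys)"
      using set_subset_list_span[of "y # ys"] Cons.prems by (auto simp del: list_span.simps)
    have IH: "list_indpt (ys @ xs)"
      "list_span (ys @ xs) \<subseteq> {u \<oplus>\<^bsub>V\<^esub> w | u w. u \<in> list_span ys \<and> w \<in> list_span xs}"
      using Cons.IH Cons.prems sub by (auto simp del: list_span.simps)
    have "y \<notin> list_span (ys @ xs)"
    proof
      assume "y \<in> list_span (ys @ xs)"
      then obtain u w where uw: "u \<in> list_span ys" "w \<in> list_span xs" "y = u \<oplus>\<^bsub>V\<^esub> w" using IH by blast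
      have uwV: "u \<in> carrier V" "w \<in> carrier V" using uw S submodule.subset by blast+
      \<comment> \<open>Now w = y - u lies in both spans, so it is zero and y falls into the span of
        \<open>ys\<close>.\<close>
      have "w = \<ominus>\<^bsub>V\<^esub> u \<oplus>\<^bsub>V\<^esub> y" using uw(3) uwV by (simp add: M.a_assoc[symmetric] M.l_neg)
      hence "w \<in> list_span (y # ys)"
        using yin sub uw(1) S submodule_neg_closed by (auto intro!: submodule.m_closed simp del: list_span.simps)
      hence "w = \<zero>\<^bsub>V\<^esub>" using uw Cons.prems by (auto simp del: list_span.simps)
      hence "y = u" using uw uwV by simp
      thus False using uw Cons.prems by auto
    qed
    moreover have "list_span (y # (ys @ xs)) \<subseteq> {u \<oplus>\<^bsub>V\<^esub> w | u w. u \<in> list_span (y # ys) \<and> w \<in> list_span xs}"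
    proof
      fix z assume "z \<in> list_span (y # (ys @ xs))"
      then obtain c u w where *: "c \<in> carrier K" "u \<in> list_span ys" "w \<in> list_span xs"
        "z = c \<odot>\<^bsub>V\<^esub> y \<oplus>\<^bsub>V\<^esub> (u \<oplus>\<^bsub>V\<^esub> w)" using IH(2) by auto
      have "u \<in> carrier V" "w \<in> carrier V" using * S submodule.subset by blast+
      hence "z = (c \<odot>\<^bsub>V\<^esub> y \<oplus>\<^bsub>V\<^esub> u) \<oplus>\<^bsub>V\<^esub> w" using * y by (simp add: M.a_assoc)
      thus "z \<in> {u \<oplus>\<^bsub>V\<^esub> w | u w. u \<in> list_span (y # ys) \<and> w \<in> list_span xs}" using * by auto
    qed
    ultimately show ?case using IH y by auto
  qed
  thus ?thesis ..
qed

lemma list_indpt_appendD: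
  assumes "list_indpt (ys @ xs)"
  shows "list_indpt ys" "list_indpt xs"
proof -
  show "list_indpt xs" using assms by (induction ys) auto
  show "list_indpt ys" using assms
  proof (induction ys)
    case (Cons y ys)
    have V: "set (ys @ xs) \<subseteq> carrier V" using Cons list_indpt_carrier by fastforce
    have "list_span ys \<subseteq> list_span (ys @ xs)"
      using list_span_least[OF list_span_submodule[OF V], of ys] set_subset_list_span[OF V] by auto
    thus ?case using Cons by auto
  qed simp
qed

text \<open>The formula also holds when \<open>k\<close> exceeds the codimension, because then one of the factors vanishes.\<close>

lemma card_indpt_extensions:
  assumes W: "submodule K W V" and xs: "list_indpt xs" "set xs \<subseteq> W"
  shows "finite {ys. length ys = k \<and> set ys \<subseteq> W \<and> list_indpt (ys @ xs)} \<and>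
    real (card {ys. length ys = k \<and> set ys \<subseteq> W \<and> list_indpt (ys @ xs)}) =
    (\<Prod>i<k. real (card W) - real (card (carrier K)) ^ (length xs + i))"
proof (induction k)
  case 0
  have "{ys. length ys = 0 \<and> set ys \<subseteq> W \<and> list_indpt (ys @ xs)} = {[]}" using xs by auto
  thus ?case by simp
next
  case (Suc k)
  let ?X = "\<lambda>k. {ys. length ys = k \<and> set ys \<subseteq> W \<and> list_indpt (ys @ xs)}"
  have finW: "finite W" using W submodule.subset finite_vectors finite_subset by metis
  \<comment> \<open>A tuple of length k + 1 is a tuple of length k with a new head from W outside
    the span of the rest.\<close>
  have eq: "?X (Suc k) = (\<lambda>(ys, y). y # ys) ` (SIGMA ys : ?X k. W - list_span (ys @ xs))"
    (is "_ = ?f ` ?S")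
  proof -
    have "zs \<in> ?f ` ?S" if zs: "zs \<in> ?X (Suc k)" for zs
    proof -
      obtain y ys where "zs = y # ys" using zs by (cases zs) auto
      thus ?thesis using zs by force
    qed
    thus ?thesis using W submodule.subset by (auto simp del: image_iff) blast
  qed
  have inj: "inj_on ?f ?S" by (auto simp: inj_on_def)
  have each: "real (card (W - list_span (ys @ xs))) =
    real (card W) - real (card (carrier K)) ^ (length xs + k)" if ys: "ys \<in> ?X k" for ys
  proof -
    have sub: "list_span (ys @ xs) \<subseteq> W" using ys xs by (intro list_span_least[OF W]) auto
    have c: "card (list_span (ys @ xs)) = card (carrier K) ^ (length xs + k)"
      using card_list_span[of "ys @ xs"] ys by (auto simp: add.commute)
    have "card (W - list_span (ys @ xs)) = card W - card (list_span (ys @ xs))"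
      using sub finW finite_subset by (intro card_Diff_subset) auto
    moreover have "card (list_span (ys @ xs)) \<le> card W" using sub finW by (intro card_mono)
    ultimately show ?thesis using c by (simp add: of_nat_diff)
  qed
  have fin: "finite (?X k)" using Suc by auto
  have "real (card (?X (Suc k))) = real (card ?S)" unfolding eq by (simp only: card_image[OF inj])
  also have "\<dots> = (\<Sum>ys\<in>?X k. real (card (W - list_span (ys @ xs))))"
    using fin finW by (subst card_SigmaI) auto
  also have "\<dots> = real (card (?X k)) * (real (card W) - real (card (carrier K)) ^ (length xs + k))"
    using each by simp
  finally have *: "real (card (?X (Suc k))) = (\<Prod>i<Suc k. real (card W) - real (card (carrier K)) ^ (length xs + i))"
    using Suc by simp
  have "finite (?X (Suc k))" unfolding eq using fin finW by auto
  thus ?case using * by simp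
qed

section \<open>Dimension and cardinality\<close>

lemma finite_imp_fin_dim: "fin_dim"
  unfolding fin_dim_def using finite_vectors span_is_subset2[of "carrier V"] in_own_span[of "carrier V"] by blast

lemma card_eq_card_scalars_power_dim: "card (carrier V) = card (carrier K) ^ dim"
proof -
  obtain B where B: "finite B" "basis B" using finite_basis_exists[OF finite_imp_fin_dim] by auto
  have BV: "B \<subseteq> carrier V" using B basis_def by auto
  have *: "\<forall>v. v\<in> carrier V \<longrightarrow> (\<exists>! a. a\<in>B \<rightarrow>\<^sub>E carrier K \<and> lincomb a B = v)"
    using basis_criterion[OF B(1) BV] B by auto
  have "bij_betw (\<lambda>a. lincomb a B) (B \<rightarrow>\<^sub>E carrier K) (carrier V)"
  proof (rule bij_betw_imageI)
    have cl: "lincomb a B \<in> carrier V" if "a \<in> B \<rightarrow>\<^sub>E carrier K" for a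
      using that BV by (intro lincomb_closed) auto
    show "inj_on (\<lambda>a. lincomb a B) (B \<rightarrow>\<^sub>E carrier K)"
      using * cl by (intro inj_onI) blast
    show "(\<lambda>a. lincomb a B) ` (B \<rightarrow>\<^sub>E carrier K) = carrier V"
      using * cl by blast
  qed
  hence "card (carrier V) = card (B \<rightarrow>\<^sub>E carrier K)" by (simp add: bij_betw_same_card)
  thus ?thesis using dim_basis[OF B] B(1) by (simp add: card_PiE)
qed

lemma two_le_card_scalars: "card (carrier K) \<ge> 2"
proof -
  have "card {\<zero>\<^bsub>K\<^esub>, \<one>\<^bsub>K\<^esub>} \<le> card (carrier K)" using finite_scalars by (intro card_mono) auto
  thus ?thesis by simp
qed

text \<open>Translates the dimensions in the definitions of rank and of codes into
  cardinalities.\<close>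

lemma card_subspace:
  assumes "submodule K W V"
  shows "card W = card (carrier K) ^ vectorspace.dim K (V\<lparr>carrier := W\<rparr>)"
proof -
  have "subspace K W V" using assms by (simp add: subspace_def vectorspace_axioms)
  then interpret W: vectorspace K "V\<lparr>carrier := W\<rparr>" by (rule subspace_is_vs)
  interpret W: finite_vectorspace K "V\<lparr>carrier := W\<rparr>"
    using finite_scalars finite_vectors submodule.subset[OF assms] finite_subset
    by unfold_locales auto
  show ?thesis using W.card_eq_card_scalars_power_dim by simp
qed

end

section \<open>The power series of the count\<close>

definition gl_card :: "real \<Rightarrow> nat \<Rightarrow> real" where
  "gl_card q n = (\<Prod>i<n. q ^ n - q ^ i)"

text \<open>Equals (q - 1)^k times the q-factorial of k.\<close>

definition qfac :: "real \<Rightarrow> nat \<Rightarrow> real" where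
  "qfac q k = (\<Prod>j<k. q ^ Suc j - 1)"

text \<open>The coefficient of order \<open>k\<close> equals \<open>(-1)^k q^(k choose 2) / |GL k|\<close>.\<close>

definition fps_ker :: "real \<Rightarrow> real fps" where
  "fps_ker q = Abs_fps (\<lambda>k. (-1) ^ k / qfac q k)"

text \<open>The coefficient of order \<open>k\<close> equals \<open>q^(k\<^sup>2) / |GL k|\<close>, where \<open>q^(k\<^sup>2)\<close> counts all matrices of size \<open>k\<close>.\<close>

definition fps_mat :: "real \<Rightarrow> real fps" where
  "fps_mat q = Abs_fps (\<lambda>k. 1 / (\<Prod>j<k. 1 - 1 / q ^ Suc j))"

section \<open>Alternating sums over the subspace lattice\<close>

lemma power_Suc_gt_1: "q > 1 \<Longrightarrow> q ^ Suc j > (1::real)"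
  by (rule one_less_power) auto

lemma qfac_pos: "q > 1 \<Longrightarrow> qfac q k > 0"
  unfolding qfac_def using power_Suc_gt_1[of q] by (intro prod_pos) auto

lemma euler_partial_prod_pos: "q > 1 \<Longrightarrow> (\<Prod>j<k. 1 - 1 / q ^ Suc j) > (0::real)"
  using power_Suc_gt_1[of q] by (intro prod_pos) (auto simp: divide_less_eq simp del: power_Suc)

text \<open>For an arbitrary value Q the sum telescopes: the previous total and the new summand
  share the product \<open>P\<close>, and -(z - 1) + (Q - 1) = Q - z.\<close>

lemma alternating_sum_qfac:
  assumes "q > (1::real)"
  shows "(\<Sum>k\<le>m. (-1) ^ k / qfac q k * (\<Prod>i<k. Q - q ^ i)) =
    (-1) ^ m * (\<Prod>i<m. Q - q ^ Suc i) / qfac q m"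
proof (induction m)
  case 0
  show ?case by (simp add: qfac_def)
next
  case (Suc m)
  have nz: "q ^ Suc m - 1 \<noteq> 0" using power_Suc_gt_1[OF assms, of m] by simp
  have [simp]: "qfac q m \<noteq> 0" using qfac_pos[OF assms, of m] by simp
  have q: "qfac q (Suc m) = qfac q m * (q ^ Suc m - 1)" by (simp add: qfac_def)
  have p: "(\<Prod>i<Suc m. Q - q ^ i) = (Q - 1) * (\<Prod>i<m. Q - q ^ Suc i)"
    by (subst prod.lessThan_Suc_shift) simp
  define P where "P = (\<Prod>i<m. Q - q ^ Suc i)"
  define z where "z = q ^ Suc m"
  have "(\<Sum>k\<le>Suc m. (-1) ^ k / qfac q k * (\<Prod>i<k. Q - q ^ i)) =
     (-1) ^ m * P / qfac q m + (-1) ^ Suc m / (qfac q m * (z - 1)) * ((Q - 1) * P)"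
    using Suc by (simp only: sum.atMost_Suc p q P_def z_def)
  also have "\<dots> = (-1) ^ Suc m * (P * (Q - z)) / (qfac q m * (z - 1))"
    using nz unfolding z_def[symmetric] by (simp add: field_simps)
  finally show ?case unfolding q by (simp add: P_def z_def)
qed

text \<open>Moebius inversion in the lattice of subspaces: the summand is (-1)^k q^(k choose 2)
  times the number of k-dimensional subspaces of a d-dimensional space. For 0 < d \<le> m a factor
  in the closed form vanishes.\<close>

lemma alternating_sum_qfac_power:
  assumes "q > (1::real)" "d \<le> m"
  shows "(\<Sum>k\<le>m. (-1) ^ k / qfac q k * (\<Prod>i<k. q ^ d - q ^ i)) = (if d = 0 then 1 else 0)"
proof (cases "d = 0")
  case True
  \<comment> \<open>For d = 0 each factor 1 - q^(i + 1) absorbs one sign.\<close>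
  have "(-1) ^ m * (\<Prod>i<m. 1 - q ^ Suc i) = (\<Prod>i<m. (-1) * (1 - q ^ Suc i))"
    by (simp only: prod.distrib prod_constant) simp
  also have "\<dots> = qfac q m" by (simp add: qfac_def)
  finally show ?thesis
    using alternating_sum_qfac[OF assms(1), where Q = 1] True qfac_pos[OF assms(1), of m] by simp
next
  case False
  then obtain e where e: "d = Suc e" by (cases d) auto
  have "(\<Prod>i<m. q ^ d - q ^ Suc i) = 0" using e assms by (intro prod_zero) auto
  thus ?thesis using False by (simp only: alternating_sum_qfac[OF assms(1)]) simp
qed

section \<open>The order of the general linear group\<close>

lemma gl_card_eq:
  assumes "q > 1"
  shows "gl_card q n = q ^ (n * n) * (\<Prod>j<n. 1 - 1 / q ^ Suc j)"
proof -
  \<comment> \<open>In reversed order the factor of index j is q^n times 1 - 1 / q^(j + 1).\<close>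
  have "gl_card q n = (\<Prod>i<n. q ^ n - q ^ (n - Suc i))"
    unfolding gl_card_def by (subst prod.nat_diff_reindex[symmetric]) simp
  also have "\<dots> = (\<Prod>j<n. q ^ n * (1 - 1 / q ^ Suc j))"
  proof (rule prod.cong)
    fix j assume "j \<in> {..<n}"
    hence "q ^ n = q ^ (n - Suc j) * q ^ Suc j" by (simp add: power_add[symmetric] del: power_Suc)
    thus "q ^ n - q ^ (n - Suc j) = q ^ n * (1 - 1 / q ^ Suc j)" using assms by (simp add: field_simps)
  qed simp
  finally show ?thesis by (simp add: prod.distrib power_mult)
qed

lemma prod_lessThan_add:
  fixes f :: "nat \<Rightarrow> real"
  shows "(\<Prod>i<K + m. f i) = (\<Prod>i<K. f i) * (\<Prod>i<m. f (K + i))"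
  by (induction m) (simp_all add: mult.assoc)

text \<open>Base case of the later count: the matrices with prescribed values on K independent
  vectors, weighted by the number of independent K-tuples. The last m = n - K factors of |GL n| are
  q^K times those of |GL m|.\<close>

lemma gl_card_partial:
  assumes q: "q > 1" and K: "K \<le> n"
  shows "q ^ (n * (n - K)) * (\<Prod>i<K. q ^ n - q ^ i) = gl_card q n * fps_nth (fps_mat q) (n - K)"
proof -
  define m where "m = n - K"
  have n: "n = K + m" using K by (simp add: m_def)
  have "gl_card q n = (\<Prod>i<K. q ^ n - q ^ i) * (\<Prod>i<m. q ^ n - q ^ (K + i))"
    unfolding gl_card_def using prod_lessThan_add[of "\<lambda>i. q ^ n - q ^ i" K m] n by simp
  also have "(\<Prod>i<m. q ^ n - q ^ (K + i)) = (\<Prod>i<m. q ^ K * (q ^ m - q ^ i))"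
    by (simp add: n power_add right_diff_distrib)
  also have "\<dots> = q ^ (K * m) * gl_card q m"
    by (simp add: prod.distrib gl_card_def power_mult)
  also have "\<dots> = q ^ (n * m) * (\<Prod>j<m. 1 - 1 / q ^ Suc j)"
    unfolding gl_card_eq[OF q] by (simp add: n add_mult_distrib power_add)
  finally have "gl_card q n = (\<Prod>i<K. q ^ n - q ^ i) * (q ^ (n * m) * (\<Prod>j<m. 1 - 1 / q ^ Suc j))" .
  moreover have "(\<Prod>j<m. 1 - 1 / q ^ Suc j) * fps_nth (fps_mat q) m = 1"
    using euler_partial_prod_pos[OF q, of m] by (simp add: fps_mat_def del: prod_zero_iff)
  ultimately show ?thesis unfolding m_def[symmetric] by simp
qed

section \<open>Functional equations between the series\<close>

lemma fps_mult_geometric_nth: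
  fixes f :: "'a::comm_ring_1 fps"
  shows "fps_nth (f * Abs_fps (\<lambda>_. 1)) n = (\<Sum>k\<le>n. fps_nth f k)"
  by (simp add: fps_mult_nth atLeast0AtMost)

text \<open>The coefficients of positive order in B(q u) = (1 - u) B(u), where B =
  \<open>fps_ker q\<close>.\<close>

lemma fps_ker_recurrence:
  assumes "q > 1"
  shows "fps_nth (fps_ker q) (Suc k) * q ^ Suc k = fps_nth (fps_ker q) (Suc k) - fps_nth (fps_ker q) k"
proof -
  have "q ^ Suc k - 1 \<noteq> 0" using power_Suc_gt_1[OF assms, of k] by simp
  hence "(fps_nth (fps_ker q) (Suc k)) * (q ^ Suc k - 1) = - fps_nth (fps_ker q) k"
    by (simp add: fps_ker_def qfac_def power_Suc[of "-1"] del: power_Suc)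
  thus ?thesis by (simp add: right_diff_distrib del: power_Suc)
qed

text \<open>The coefficients of positive order in A(u / q) = (1 - u) A(u), where A =
  \<open>fps_mat q\<close>.\<close>

lemma fps_mat_recurrence:
  assumes "q > 1"
  shows "fps_nth (fps_mat q) (Suc k) / q ^ Suc k = fps_nth (fps_mat q) (Suc k) - fps_nth (fps_mat q) k"
proof -
  have *: "1 / (P * (1 - 1 / z)) / z = 1 / (P * (1 - 1 / z)) - 1 / P" if "z > 1" "P > 0" for z P :: real
    using that by (simp add: divide_simps)
  show ?thesis
    using *[OF power_Suc_gt_1[OF assms, of k] euler_partial_prod_pos[OF assms, of k]] by (simp add: fps_mat_def)
qed

text \<open>This is \<open>A(u / q)\<close> for \<open>A = fps_mat q\<close>; by Fine and Herstein its coefficients count nilpotent matrices, weighted by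
  \<open>1 / |GL k|\<close>.\<close>

definition fps_nilp :: "real \<Rightarrow> real fps" where
  "fps_nilp q = Abs_fps (\<lambda>k. fps_nth (fps_mat q) k / q ^ k)"

lemma fps_nilp_eq:
  assumes "q > 1"
  shows "fps_mat q * (1 - fps_X) = fps_nilp q"
proof (rule fps_ext)
  fix n show "fps_nth (fps_mat q * (1 - fps_X)) n = fps_nth (fps_nilp q) n"
    using fps_mat_recurrence[OF assms]
    by (cases n) (auto simp: right_diff_distrib fps_nilp_def simp del: power_Suc)
qed

text \<open>The product D(u) = B(u) A(u / q) satisfies D(q u) = B(q u) A(u) = B(u) (1 - u) A(u) =
  D(u), so its coefficients of positive order vanish.\<close>

lemma fps_ker_times_nilp:
  assumes "q > 1"
  shows "fps_ker q * fps_nilp q = 1"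
proof (rule fps_ext)
  fix n
  define D where "D = fps_ker q * fps_nilp q"
  have "D = fps_ker q * (1 - fps_X) * fps_mat q"
    unfolding D_def fps_nilp_eq[OF assms, symmetric] by (simp add: mult_ac)
  also have "fps_ker q * (1 - fps_X) = Abs_fps (\<lambda>k. fps_nth (fps_ker q) k * q ^ k)"
  proof (rule fps_ext)
    fix n show "fps_nth (fps_ker q * (1 - fps_X)) n = fps_nth (Abs_fps (\<lambda>k. fps_nth (fps_ker q) k * q ^ k)) n"
      using fps_ker_recurrence[OF assms] by (cases n) (auto simp: right_diff_distrib simp del: power_Suc)
  qed
  finally have D: "D = Abs_fps (\<lambda>k. fps_nth (fps_ker q) k * q ^ k) * fps_mat q" .
  \<comment> \<open>The coefficients of D(q u); the power q^n is split between the factors, and q^(n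
    - i) turns A(u / q) back into A(u).\<close>
  have "q ^ n * fps_nth D n = (\<Sum>i=0..n. q ^ n * (fps_nth (fps_ker q) i * fps_nth (fps_nilp q) (n - i)))"
    by (simp add: D_def fps_mult_nth sum_distrib_left)
  also have "\<dots> = (\<Sum>i=0..n. (fps_nth (fps_ker q) i * q ^ i) * fps_nth (fps_mat q) (n - i))"
  proof (rule sum.cong)
    fix i assume "i \<in> {0..n}"
    hence "q ^ n = q ^ i * q ^ (n - i)" by (simp add: power_add[symmetric])
    thus "q ^ n * (fps_nth (fps_ker q) i * fps_nth (fps_nilp q) (n - i)) =
        (fps_nth (fps_ker q) i * q ^ i) * fps_nth (fps_mat q) (n - i)"
      using assms by (simp add: fps_nilp_def)
  qed simp
  also have "\<dots> = fps_nth D n" by (simp add: D fps_mult_nth)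
  finally have *: "(q ^ n - 1) * fps_nth D n = 0" by (simp add: left_diff_distrib)
  show "fps_nth (fps_ker q * fps_nilp q) n = fps_nth 1 n"
  proof (cases n)
    case 0
    thus ?thesis by (simp add: fps_ker_def fps_nilp_def fps_mat_def qfac_def)
  next
    case (Suc m)
    hence "q ^ n - 1 \<noteq> 0" using power_Suc_gt_1[OF assms, of m] by simp
    thus ?thesis using * Suc D_def by simp
  qed
qed

lemma fps_geometric: "Abs_fps (\<lambda>_. 1) * (1 - fps_X) = (1 :: real fps)"
proof (rule fps_ext)
  fix n show "fps_nth (Abs_fps (\<lambda>_. 1) * (1 - fps_X)) n = fps_nth (1 :: real fps) n"
    by (cases n) (auto simp: right_diff_distrib)
qed

lemma fps_ker_times_mat:
  assumes "q > 1"
  shows "fps_ker q * fps_mat q = Abs_fps (\<lambda>_. 1)"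
proof -
  have "fps_ker q * fps_mat q = (fps_ker q * fps_mat q) * (Abs_fps (\<lambda>_. 1) * (1 - fps_X))"
    by (simp only: fps_geometric) simp
  also have "\<dots> = fps_ker q * (fps_mat q * (1 - fps_X)) * Abs_fps (\<lambda>_. 1)" by (simp only: mult_ac)
  finally show ?thesis by (simp only: fps_nilp_eq[OF assms] fps_ker_times_nilp[OF assms]) simp
qed

text \<open>One factor B turns A into the geometric series, and multiplication by that series forms
  partial sums.\<close>

lemma fps_ker_power_times_mat_nth:
  assumes "q > 1"
  shows "fps_nth (fps_ker q ^ Suc m * fps_mat q) n = (\<Sum>k\<le>n. fps_nth (fps_ker q ^ m) k)"
proof -
  have "fps_ker q ^ Suc m * fps_mat q = fps_ker q ^ m * (fps_ker q * fps_mat q)" by (simp add: mult_ac)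
  thus ?thesis by (simp only: fps_ker_times_mat[OF assms] fps_mult_geometric_nth)
qed

section \<open>Values of the series at u = 1: Euler's function at 1 / q\<close>

definition euler_prod :: "real \<Rightarrow> real" where
  "euler_prod q = (\<Prod>i. 1 - 1 / q ^ Suc i)"

text \<open>Absolute convergence comes from a geometric series, and a convergent product without
  zero factors is nonzero.\<close>

lemma euler_prod:
  assumes "q > 1"
  shows "(\<lambda>n. \<Prod>i<n. 1 - 1 / q ^ Suc i) \<longlonglongrightarrow> euler_prod q" "euler_prod q \<noteq> 0"
proof -
  have nz: "1 - 1 / q ^ Suc i \<noteq> 0" for i
    using power_Suc_gt_1[OF assms, of i] by (simp del: power_Suc)
  have "summable (\<lambda>i. (1 / q) ^ Suc i)"
    using assms by (subst summable_Suc_iff) (auto intro!: summable_geometric)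
  hence "summable (\<lambda>i. norm ((1 - 1 / q ^ Suc i) - 1))"
    using assms by (simp add: power_one_over)
  hence conv: "convergent_prod (\<lambda>i. 1 - 1 / q ^ Suc i)"
    by (intro abs_convergent_prod_imp_convergent_prod summable_imp_abs_convergent_prod)
  hence "(\<lambda>i. 1 - 1 / q ^ Suc i) has_prod euler_prod q"
    unfolding euler_prod_def by (rule convergent_prod_has_prod)
  from has_prod_imp_tendsto'[OF this]
  show "(\<lambda>n. \<Prod>i<n. 1 - 1 / q ^ Suc i) \<longlonglongrightarrow> euler_prod q" .
  show "euler_prod q \<noteq> 0"
    unfolding euler_prod_def by (rule prodinf_nonzero[OF conv nz])
qed

lemma prodinf_power_euler_prod:
  assumes "q > 1"
  shows "(\<Prod>i. (1 - 1 / q ^ (i + 1)) ^ m) = euler_prod q ^ m"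
\<comment> \<open>Nonzero factors whose partial products tend to zero count as divergent, so the
  limit must also be shown to be nonzero.\<close>
proof (rule prodinf_eq_prod_lim')
  have "(\<lambda>n. (\<Prod>i<n. 1 - 1 / q ^ Suc i) ^ m) \<longlonglongrightarrow> euler_prod q ^ m"
    by (intro tendsto_power euler_prod assms)
  thus "(\<lambda>n. \<Prod>k<n. (1 - 1 / q ^ (k + 1)) ^ m) \<longlonglongrightarrow> euler_prod q ^ m"
    by (simp add: prod_power_distrib)
qed (use euler_prod(2)[OF assms] in simp)

text \<open>The partial sums are the coefficients of A(u) = A(u / q) / (1 - u), which are
  reciprocals of partial Euler products.\<close>

lemma fps_nilp_sums:
  assumes "q > 1"
  shows "fps_nth (fps_nilp q) sums (1 / euler_prod q)"
proof -
  have "(\<Sum>k\<le>n. fps_nth (fps_nilp q) k) = fps_nth (fps_mat q) n" for n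
  proof -
    have "fps_mat q = fps_nilp q * Abs_fps (\<lambda>_. 1)"
      using fps_nilp_eq[OF assms] fps_geometric by (metis mult.assoc mult.commute mult.left_neutral)
    thus ?thesis using fps_mult_geometric_nth[of "fps_nilp q" n] by simp
  qed
  moreover have "(\<lambda>n. fps_nth (fps_mat q) n) \<longlonglongrightarrow> 1 / euler_prod q"
    unfolding fps_mat_def fps_nth_Abs_fps by (intro tendsto_divide tendsto_const euler_prod assms)
  ultimately show ?thesis by (simp add: sums_def_le)
qed

text \<open>Together with \<open>sums_fps_mult\<close> this makes evaluation at 1 multiplicative on
  absolutely convergent series.\<close>

lemma summable_norm_fps_mult:
  fixes f g :: "real fps"
  assumes "summable (\<lambda>k. norm (fps_nth f k))" "summable (\<lambda>k. norm (fps_nth g k))"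
  shows "summable (\<lambda>k. norm (fps_nth (f * g) k))"
proof (rule summable_comparison_test)
  show "summable (\<lambda>k. \<Sum>i\<le>k. norm (fps_nth f i) * norm (fps_nth g (k - i)))"
    using assms by (intro summable_Cauchy_product) auto
  show "\<exists>N. \<forall>n\<ge>N. norm (norm (fps_nth (f * g) n)) \<le> (\<Sum>i\<le>n. norm (fps_nth f i) * norm (fps_nth g (n - i)))"
    unfolding fps_mult_nth atLeast0AtMost norm_mult[symmetric] by (auto intro: norm_sum simp del: norm_mult)
qed

lemma sums_fps_mult:
  fixes f g :: "real fps"
  assumes "summable (\<lambda>k. norm (fps_nth f k))" "summable (\<lambda>k. norm (fps_nth g k))"
  shows "fps_nth (f * g) sums ((\<Sum>k. fps_nth f k) * (\<Sum>k. fps_nth g k))"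
  using Cauchy_product_sums[OF assms] by (simp add: fps_mult_nth atLeast0AtMost cong: sums_cong)

lemma summable_fps_ker:
  assumes "q > 1"
  shows "summable (\<lambda>k. norm (fps_nth (fps_ker q) k))"
proof -
  \<comment> \<open>From here on the ratio 1 / (q^(n + 1) - 1) of successive coefficients is below
    1/2; for q = 2 the first ratio is still 1.\<close>
  obtain N where N: "q ^ N > 3" using real_arch_pow[OF assms] by blast
  show ?thesis
  proof (rule summable_ratio_test[of "1/2" N])
    fix n assume n: "n \<ge> N"
    have "q ^ N \<le> q ^ Suc n" using n assms by (intro power_increasing) auto
    hence z: "q ^ Suc n > 3" using N by linarith
    have "norm (fps_nth (fps_ker q) (Suc n)) = norm (fps_nth (fps_ker q) n) * (1 / (q ^ Suc n - 1))"
      using z qfac_pos[OF assms, of n] qfac_pos[OF assms, of "Suc n"]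
      by (simp add: fps_ker_def qfac_def abs_mult norm_power del: power_Suc)
    also have "\<dots> \<le> norm (fps_nth (fps_ker q) n) * (1/2)"
      using z by (intro mult_left_mono) (auto simp: divide_simps simp del: power_Suc)
    finally show "norm (norm (fps_nth (fps_ker q) (Suc n))) \<le> 1/2 * norm (norm (fps_nth (fps_ker q) n))"
      by simp
  qed simp
qed

text \<open>Evaluation of B(u) A(u / q) = 1 at u = 1. The second factor converges absolutely since
  its coefficients are nonnegative.\<close>

lemma suminf_fps_ker:
  assumes "q > 1"
  shows "(\<Sum>k. fps_nth (fps_ker q) k) = euler_prod q"
proof -
  have nn: "fps_nth (fps_nilp q) k \<ge> 0" for k
    using euler_partial_prod_pos[OF assms, of k] assms by (simp add: fps_nilp_def fps_mat_def)
  have "summable (\<lambda>k. norm (fps_nth (fps_nilp q) k))"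
    using fps_nilp_sums[OF assms] nn by (simp add: sums_iff)
  hence "fps_nth (fps_ker q * fps_nilp q) sums ((\<Sum>k. fps_nth (fps_ker q) k) * (\<Sum>k. fps_nth (fps_nilp q) k))"
    by (intro sums_fps_mult summable_fps_ker assms)
  moreover have "fps_nth (1 :: real fps) sums 1"
    using sums_single[of 0 "\<lambda>_. 1 :: real"] by (simp add: fps_one_nth cong: sums_cong if_cong)
  moreover have "(\<Sum>k. fps_nth (fps_nilp q) k) = 1 / euler_prod q"
    using fps_nilp_sums[OF assms] by (simp add: sums_iff)
  ultimately have "(\<Sum>k. fps_nth (fps_ker q) k) * (1 / euler_prod q) = 1"
    unfolding fps_ker_times_nilp[OF assms] by (metis sums_unique2)
  thus ?thesis using euler_prod(2)[OF assms] by simp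
qed

lemma fps_ker_power_sums:
  assumes "q > 1"
  shows "summable (\<lambda>k. norm (fps_nth (fps_ker q ^ m) k)) \<and> fps_nth (fps_ker q ^ m) sums (euler_prod q ^ m)"
proof (induction m)
  case 0
  have "fps_nth (1 :: real fps) = (\<lambda>k. if k = 0 then 1 else 0)" by (simp add: fps_one_nth fun_eq_iff)
  thus ?case using sums_single[of 0 "\<lambda>_. 1 :: real"] by (simp add: sums_iff if_distrib cong: if_cong)
next
  case (Suc m)
  thus ?case
    using summable_norm_fps_mult[OF summable_fps_ker[OF assms], of "fps_ker q ^ m"]
      sums_fps_mult[OF summable_fps_ker[OF assms], of "fps_ker q ^ m"]
    by (simp add: suminf_fps_ker[OF assms] sums_iff)
qed

lemma fps_ker_power_partial_sums_limit:
  assumes "q > 1"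
  shows "(\<lambda>n. \<Sum>k\<le>n. fps_nth (fps_ker q ^ m) k) \<longlonglongrightarrow> euler_prod q ^ m"
  using fps_ker_power_sums[OF assms, of m] by (simp add: sums_def_le)

section \<open>Coefficients of B^(r - 1) for growing r\<close>

lemma qfac_at_top: "k \<ge> 1 \<Longrightarrow> filterlim (\<lambda>r. qfac (real r) k) at_top at_top"
proof (induction k rule: nat_induct_at_least)
  case base
  show ?case unfolding qfac_def by simp real_asymp
next
  case (Suc k)
  have "filterlim (\<lambda>r. qfac (real r) k * (real r ^ Suc k - 1)) at_top at_top"
  proof (rule filterlim_at_top_mult_at_top[OF Suc.IH])
    show "LIM r sequentially. real r ^ Suc k - 1 :> at_top"
      by real_asymp
  qed
  thus ?case by (simp add: qfac_def)
qed

lemma fps_ker_nth_tendsto_0: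
  assumes "k \<ge> 1"
  shows "(\<lambda>r. fps_nth (fps_ker (real r)) k) \<longlonglongrightarrow> 0"
  unfolding fps_ker_def fps_nth_Abs_fps
  by (rule tendsto_divide_0[OF tendsto_const filterlim_at_top_imp_at_infinity[OF qfac_at_top[OF assms]]])

text \<open>The factor r - 1 cancels the first factor of \<open>qfac\<close>. Nothing else remains
  for k = 1, and for larger k the other factors grow.\<close>

lemma scaled_fps_ker_nth_tendsto:
  assumes "k \<ge> 1"
  shows "(\<lambda>r. real (r - 1) * fps_nth (fps_ker (real r)) k) \<longlonglongrightarrow> (if k = 1 then -1 else 0)"
proof -
  obtain j where j: "k = Suc j" using assms by (cases k) auto
  have ev: "eventually (\<lambda>r. real (r - 1) * fps_nth (fps_ker (real r)) k =
      (-1) ^ k / (\<Prod>i<j. real r ^ Suc (Suc i) - 1)) sequentially"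
    \<comment> \<open>At r = 1 the cancelled factor is zero, and at r = 0 the natural subtraction is
      truncated.\<close>
    using eventually_ge_at_top[of 2]
  proof eventually_elim
    case (elim r)
    have "qfac (real r) k = (real r - 1) * (\<Prod>i<j. real r ^ Suc (Suc i) - 1)"
      unfolding j qfac_def by (subst prod.lessThan_Suc_shift) simp
    moreover have "real (r - 1) = real r - 1" using elim by (simp add: of_nat_diff)
    moreover have "real r - 1 \<noteq> 0" using elim by simp
    ultimately show ?case by (simp add: fps_ker_def del: power_Suc)
  qed
  have "(\<lambda>r. (-1) ^ k / (\<Prod>i<j. real r ^ Suc (Suc i) - 1)) \<longlonglongrightarrow> (if k = 1 then -1 else 0)"
  proof (cases "k = 1")
    case True
    thus ?thesis using j by simp
  next
    case False
    then obtain l where l: "j = Suc l" using j by (cases j) auto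
    have "filterlim (\<lambda>r. \<Prod>i<Suc l. real r ^ Suc (Suc i) - 1) at_top sequentially"
    proof (induction l)
      case 0
      show ?case by simp real_asymp
    next
      case (Suc l)
      have "filterlim (\<lambda>r. (\<Prod>i<Suc l. real r ^ Suc (Suc i) - 1) * (real r ^ Suc (Suc (Suc l)) - 1)) at_top sequentially"
      proof (rule filterlim_at_top_mult_at_top[OF Suc.IH])
        show "LIM r sequentially. real r ^ Suc (Suc (Suc l)) - 1 :> at_top" by real_asymp
      qed
      thus ?case by (simp add: mult_ac)
    qed
    from tendsto_divide_0[OF tendsto_const filterlim_at_top_imp_at_infinity[OF this], of "(-1) ^ k"]
    show ?thesis using False l by simp
  qed
  thus ?thesis using tendsto_cong[OF ev] by simp
qed

text \<open>C = B^(r - 1) satisfies C' B = (r - 1) B' C. Coefficientwise B tends to 1 and (r - 1) B'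
  to -1, so the limit solves c' = -c with c(0) = 1 and is exp(-u).\<close>

lemma fps_ker_power_nth_limit:
  "(\<lambda>r. fps_nth (fps_ker (real r) ^ (r - 1)) k) \<longlonglongrightarrow> (-1) ^ k / fact k"
proof (induction k rule: less_induct)
  case (less k)
  define B where "B = (\<lambda>r. fps_ker (real r))"
  define C where "C = (\<lambda>r. fps_ker (real r) ^ (r - 1))"
  have B0: "fps_nth (B r) 0 = 1" for r by (simp add: B_def fps_ker_def qfac_def)
  show ?case
  proof (cases k)
    case 0
    have "fps_nth (C r) 0 = 1" for r using B0[of r] by (simp add: C_def B_def fps_power_zeroth)
    thus ?thesis using 0 by (simp add: C_def)
  next
    case (Suc j)
    \<comment> \<open>The coefficient of order j in this equation, solved for the coefficient of
      \<open>C r\<close> of order k = j + 1; all others on the right have lower order.\<close>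
    have rec: "real k * fps_nth (C r) k =
      (\<Sum>i\<le>j. real (r - 1) * fps_nth (B r) (Suc i) * real (Suc i) * fps_nth (C r) (j - i)) -
      (\<Sum>i<j. real (Suc i) * fps_nth (C r) (Suc i) * fps_nth (B r) (j - i))" if r: "r \<ge> 2" for r
    proof -
      have "fps_deriv (C r) * B r = of_nat (r - 1) * fps_deriv (B r) * (B r ^ (r - 1 - 1) * B r)"
        unfolding C_def B_def by (simp add: fps_deriv_power' mult_ac)
      \<comment> \<open>As r \<ge> 2, the exponent r - 1 - 1 is not truncated.\<close>
      also have "B r ^ (r - 1 - 1) * B r = C r"
        using r by (simp add: C_def B_def power_Suc2[symmetric] Suc_diff_Suc numeral_2_eq_2 del: power_Suc)
      finally have "fps_nth (fps_deriv (C r) * B r) j = fps_nth (of_nat (r - 1) * (fps_deriv (B r) * C r)) j"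
        by (simp add: mult_ac)
      hence "(\<Sum>i\<le>j. real (Suc i) * fps_nth (C r) (Suc i) * fps_nth (B r) (j - i)) =
         real (r - 1) * (\<Sum>i\<le>j. real (Suc i) * fps_nth (B r) (Suc i) * fps_nth (C r) (j - i))"
        by (simp only: fps_mult_of_nat_nth) (simp add: fps_mult_nth atLeast0AtMost)
      moreover have "(\<Sum>i\<le>j. real (Suc i) * fps_nth (C r) (Suc i) * fps_nth (B r) (j - i)) =
        (\<Sum>i<j. real (Suc i) * fps_nth (C r) (Suc i) * fps_nth (B r) (j - i)) + real k * fps_nth (C r) k"
        using B0 Suc by (simp add: lessThan_Suc_atMost[symmetric])
      ultimately show ?thesis by (simp add: sum_distrib_left mult_ac)
    qed
    have lim1: "(\<lambda>r. \<Sum>i\<le>j. real (r - 1) * fps_nth (B r) (Suc i) * real (Suc i) * fps_nth (C r) (j - i))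
      \<longlonglongrightarrow> (\<Sum>i\<le>j. (if Suc i = 1 then -1 else 0) * real (Suc i) * ((-1) ^ (j - i) / fact (j - i)))"
      unfolding B_def C_def using Suc
      by (intro tendsto_sum tendsto_mult tendsto_const scaled_fps_ker_nth_tendsto less) auto
    \<comment> \<open>Since j - i > 0, each summand contains a coefficient of B that tends to
      0.\<close>
    have lim2: "(\<lambda>r. \<Sum>i<j. real (Suc i) * fps_nth (C r) (Suc i) * fps_nth (B r) (j - i))
      \<longlonglongrightarrow> (\<Sum>i<j. real (Suc i) * ((-1) ^ Suc i / fact (Suc i)) * 0)"
      unfolding B_def C_def using Suc
      by (intro tendsto_sum tendsto_mult tendsto_const fps_ker_nth_tendsto_0 less) auto
    have s1: "(\<Sum>i\<le>j. (if Suc i = 1 then -1 else 0) * real (Suc i) * ((-1) ^ (j - i) / fact (j - i))) =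
        - ((-1) ^ j / fact j)"
    proof -
      have "(\<Sum>i\<le>j. (if Suc i = 1 then -1 else 0) * real (Suc i) * ((-1) ^ (j - i) / fact (j - i))) =
          (\<Sum>i\<in>{0}. (if Suc i = 1 then -1 else 0) * real (Suc i) * ((-1) ^ (j - i) / fact (j - i)))"
        by (rule sum.mono_neutral_right) auto
      thus ?thesis by simp
    qed
    have "(\<lambda>r. ((\<Sum>i\<le>j. real (r - 1) * fps_nth (B r) (Suc i) * real (Suc i) * fps_nth (C r) (j - i)) -
      (\<Sum>i<j. real (Suc i) * fps_nth (C r) (Suc i) * fps_nth (B r) (j - i))) / real k)
       \<longlonglongrightarrow> (- ((-1) ^ j / fact j) - 0) / real k"
      using lim1 lim2 Suc unfolding s1 by (intro tendsto_divide tendsto_diff tendsto_const) auto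
    also have "(- ((-1) ^ j / fact j) - 0) / real k = (-1) ^ k / fact k"
      using Suc by (simp add: field_simps)
    finally show ?thesis
    proof (rule Lim_transform_eventually)
      show "eventually (\<lambda>r. ((\<Sum>i\<le>j. real (r - 1) * fps_nth (B r) (Suc i) * real (Suc i) * fps_nth (C r) (j - i)) -
        (\<Sum>i<j. real (Suc i) * fps_nth (C r) (Suc i) * fps_nth (B r) (j - i))) / real k =
        fps_nth (fps_ker (real r) ^ (r - 1)) k) sequentially"
        using eventually_ge_at_top[of 2]
        by eventually_elim (simp only: rec[symmetric], simp add: C_def Suc)
    qed
  qed
qed

section \<open>Limits of the explicit formula for the density\<close>

lemma density_eq:
  assumes q: "q > 1"
  shows "gl_card q n * s * gl_card q n / ((q ^ (n^2) - 1) * (q ^ (n^2) - q)) =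
    s * (\<Prod>j<n. 1 - 1 / q ^ Suc j)\<^sup>2 * (1 / ((1 - 1 / q ^ (n^2)) * (1 - q / q ^ (n^2))))"
proof -
  define z where "z = q ^ (n^2)"
  define P where "P = (\<Prod>j<n. 1 - 1 / q ^ Suc j)"
  have z: "z > 0" using q by (simp add: z_def)
  have "gl_card q n = z * P" using gl_card_eq[OF q, of n] by (simp add: z_def P_def power2_eq_square)
  \<comment> \<open>Each copy of \<open>gl_card q n\<close> contributes a factor z, and z^2 cancels
    against the denominator; every remaining factor has a limit.\<close>
  moreover have "(1 - 1 / z) * (1 - q / z) = ((z - 1) * (z - q)) / z\<^sup>2"
    using z by (simp add: field_simps power2_eq_square)
  ultimately show ?thesis
    unfolding z_def[symmetric] P_def[symmetric] using z by (simp add: power2_eq_square)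
qed

text \<open>The partial sums contribute m Euler products and the squared product two more.\<close>

lemma density_limit_n:
  assumes "q > 1"
  shows "(\<lambda>n. (\<Sum>k\<le>n. fps_nth (fps_ker q ^ m) k) * (\<Prod>j<n. 1 - 1 / q ^ Suc j)\<^sup>2 *
      (1 / ((1 - 1 / q ^ (n^2)) * (1 - q / q ^ (n^2))))) \<longlonglongrightarrow> euler_prod q ^ (m + 2)"
proof -
  have lim: "(\<lambda>n. c / q ^ (n^2)) \<longlonglongrightarrow> 0" for c :: real
    using assms by real_asymp
  have "(\<lambda>n. (\<Sum>k\<le>n. fps_nth (fps_ker q ^ m) k) * (\<Prod>j<n. 1 - 1 / q ^ Suc j)\<^sup>2 *
      (1 / ((1 - 1 / q ^ (n^2)) * (1 - q / q ^ (n^2))))) \<longlonglongrightarrow>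
      euler_prod q ^ m * (euler_prod q)\<^sup>2 * (1 / ((1 - 0) * (1 - 0)))"
    by (intro tendsto_mult tendsto_divide tendsto_diff tendsto_const tendsto_power lim
        fps_ker_power_partial_sums_limit euler_prod assms) auto
  thus ?thesis by (simp add: power_add power2_eq_square mult_ac)
qed

lemma density_limit_q:
  assumes n: "n \<ge> 2"
  shows "(\<lambda>r. (\<Sum>k\<le>n. fps_nth (fps_ker (real r) ^ (r - 1)) k) * (\<Prod>j<n. 1 - 1 / real r ^ Suc j)\<^sup>2 *
      (1 / ((1 - 1 / real r ^ (n^2)) * (1 - real r / real r ^ (n^2))))) \<longlonglongrightarrow> (\<Sum>k\<le>n. (-1) ^ k / fact k)"
proof -
  have lim1: "(\<lambda>r. 1 / real r ^ m) \<longlonglongrightarrow> 0" if "m > 0" for m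
    using that by real_asymp
  \<comment> \<open>For n = 1 this would be constantly 1; n \<ge> 2 makes the exponent
    positive.\<close>
  have "(\<lambda>r. 1 / real r ^ (n^2 - 1)) \<longlonglongrightarrow> 0"
    using n power_strict_mono[of 1 n 2] by (intro lim1) auto
  moreover have "eventually (\<lambda>r. 1 / real r ^ (n^2 - 1) = real r / real r ^ (n^2)) sequentially"
    using eventually_gt_at_top[of 0]
  proof eventually_elim
    case (elim r)
    have "n^2 = Suc (n^2 - 1)" using n by simp
    hence "real r ^ (n^2) = real r * real r ^ (n^2 - 1)" by (metis power_Suc)
    thus ?case using elim by simp
  qed
  ultimately have lim2: "(\<lambda>r. real r / real r ^ (n^2)) \<longlonglongrightarrow> 0" by (rule Lim_transform_eventually)
  have "(\<lambda>r. (\<Sum>k\<le>n. fps_nth (fps_ker (real r) ^ (r - 1)) k) * (\<Prod>j<n. 1 - 1 / real r ^ Suc j)\<^sup>2 *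
      (1 / ((1 - 1 / real r ^ (n^2)) * (1 - real r / real r ^ (n^2))))) \<longlonglongrightarrow>
      (\<Sum>k\<le>n. (-1) ^ k / fact k) * (\<Prod>j<n. 1 - 0)\<^sup>2 * (1 / ((1 - 0) * (1 - 0)))"
    using n by (intro tendsto_mult tendsto_divide tendsto_diff tendsto_const tendsto_power tendsto_sum
        tendsto_prod lim1 lim2 fps_ker_power_nth_limit) auto
  thus ?thesis by simp
qed

section \<open>Matrices over a finite field\<close>

locale finite_field_matrices = field F for F (structure) +
  fixes n :: nat
  assumes finite_carrier: "finite (carrier F)"
begin

abbreviation "q \<equiv> card (carrier F)"
abbreviation "V \<equiv> vec_sp F n"
abbreviation "Mat \<equiv> mat_sp F n n"
abbreviation "app \<equiv> mat_vec F n n"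

section \<open>Vectors, matrices and their product\<close>

lemma vec_sp_simps:
  "carrier V = {..<n} \<rightarrow>\<^sub>E carrier F" "\<zero>\<^bsub>V\<^esub> = (\<lambda>i\<in>{..<n}. \<zero>)"
  "u \<oplus>\<^bsub>V\<^esub> v = (\<lambda>i\<in>{..<n}. u i \<oplus> v i)" "c \<odot>\<^bsub>V\<^esub> v = (\<lambda>i\<in>{..<n}. c \<otimes> v i)"
  by (simp_all add: vec_sp_def func_space_def)

lemma mat_sp_simps:
  "carrier Mat = {..<n} \<times> {..<n} \<rightarrow>\<^sub>E carrier F" "\<zero>\<^bsub>Mat\<^esub> = (\<lambda>i\<in>{..<n} \<times> {..<n}. \<zero>)"
  "A \<oplus>\<^bsub>Mat\<^esub> B = (\<lambda>i\<in>{..<n} \<times> {..<n}. A i \<oplus> B i)" "c \<odot>\<^bsub>Mat\<^esub> A = (\<lambda>i\<in>{..<n} \<times> {..<n}. c \<otimes> A i)"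
  by (simp_all add: mat_sp_def func_space_def)

sublocale V: finite_vectorspace F V
proof -
  have "finite (carrier V)" unfolding vec_sp_simps using finite_carrier by (intro finite_PiE) auto
  moreover have "module F V" unfolding vec_sp_def by (rule func_space_is_module)
  ultimately show "finite_vectorspace F V"
    using finite_carrier field_axioms
    by (simp add: finite_vectorspace_def finite_vectorspace_axioms_def vectorspace_def)
qed

text \<open>Codes are subspaces of this space, so independent lists are counted among matrices as
  well as among vectors.\<close>

sublocale Mat: finite_vectorspace F Mat
proof -
  have "finite (carrier Mat)" unfolding mat_sp_simps using finite_carrier by (intro finite_PiE) auto
  moreover have "module F Mat" unfolding mat_sp_def by (rule func_space_is_module)
  ultimately show "finite_vectorspace F Mat"
    using finite_carrier field_axioms
    by (simp add: finite_vectorspace_def finite_vectorspace_axioms_def vectorspace_def)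
qed

lemma card_V: "card (carrier V) = q ^ n"
  by (simp add: vec_sp_simps card_PiE)

lemma card_Mat: "card (carrier Mat) = q ^ (n * n)"
  by (simp add: mat_sp_simps card_PiE card_cartesian_product)

lemma vec_nth_closed [simp, intro]: "v \<in> carrier V \<Longrightarrow> j < n \<Longrightarrow> v j \<in> carrier F"
  unfolding vec_sp_simps by auto

lemma mat_nth_closed [simp, intro]: "A \<in> carrier Mat \<Longrightarrow> i < n \<Longrightarrow> j < n \<Longrightarrow> A (i, j) \<in> carrier F"
  unfolding mat_sp_simps by auto

lemma app_closed [simp, intro]: "A \<in> carrier Mat \<Longrightarrow> v \<in> carrier V \<Longrightarrow> app A v \<in> carrier V"
proof -
  assume "A \<in> carrier Mat" "v \<in> carrier V"
  hence "(\<Oplus>j\<in>{..<n}. A (i, j) \<otimes> v j) \<in> carrier F" if "i < n" for i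
    using that by (intro finsum_closed) auto
  thus ?thesis by (simp add: mat_vec_def vec_sp_simps(1))
qed

lemma app_add:
  assumes "A \<in> carrier Mat" "u \<in> carrier V" "v \<in> carrier V"
  shows "app A (u \<oplus>\<^bsub>V\<^esub> v) = app A u \<oplus>\<^bsub>V\<^esub> app A v"
proof -
  have "(\<Oplus>j\<in>{..<n}. A (i, j) \<otimes> (u \<oplus>\<^bsub>V\<^esub> v) j) =
     (\<Oplus>j\<in>{..<n}. A (i, j) \<otimes> u j) \<oplus> (\<Oplus>j\<in>{..<n}. A (i, j) \<otimes> v j)" if "i < n" for i
  proof -
    have "(\<Oplus>j\<in>{..<n}. A (i, j) \<otimes> (u \<oplus>\<^bsub>V\<^esub> v) j) = (\<Oplus>j\<in>{..<n}. A (i, j) \<otimes> u j \<oplus> A (i, j) \<otimes> v j)"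
      using assms that by (intro finsum_cong') (auto simp: vec_sp_simps(3) r_distr)
    thus ?thesis using assms that by (subst (asm) finsum_addf) auto
  qed
  thus ?thesis by (auto simp: mat_vec_def vec_sp_simps(3)[of "restrict _ _"] fun_eq_iff)
qed

lemma app_smult:
  assumes "A \<in> carrier Mat" "c \<in> carrier F" "v \<in> carrier V"
  shows "app A (c \<odot>\<^bsub>V\<^esub> v) = c \<odot>\<^bsub>V\<^esub> app A v"
proof -
  have "(\<Oplus>j\<in>{..<n}. A (i, j) \<otimes> (c \<odot>\<^bsub>V\<^esub> v) j) = c \<otimes> (\<Oplus>j\<in>{..<n}. A (i, j) \<otimes> v j)" if "i < n" for i
  proof -
    have "(\<Oplus>j\<in>{..<n}. A (i, j) \<otimes> (c \<odot>\<^bsub>V\<^esub> v) j) = (\<Oplus>j\<in>{..<n}. c \<otimes> (A (i, j) \<otimes> v j))"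
      using assms that by (intro finsum_cong') (auto simp: vec_sp_simps(4) m_lcomm)
    thus ?thesis using assms that by (subst finsum_rdistr) auto
  qed
  thus ?thesis by (auto simp: mat_vec_def vec_sp_simps(4)[of _ "restrict _ _"] fun_eq_iff)
qed

lemma mat_add_app:
  assumes "A \<in> carrier Mat" "B \<in> carrier Mat" "v \<in> carrier V"
  shows "app (A \<oplus>\<^bsub>Mat\<^esub> B) v = app A v \<oplus>\<^bsub>V\<^esub> app B v"
proof -
  have "(\<Oplus>j\<in>{..<n}. (A \<oplus>\<^bsub>Mat\<^esub> B) (i, j) \<otimes> v j) =
     (\<Oplus>j\<in>{..<n}. A (i, j) \<otimes> v j) \<oplus> (\<Oplus>j\<in>{..<n}. B (i, j) \<otimes> v j)" if "i < n" for i
  proof -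
    have "(\<Oplus>j\<in>{..<n}. (A \<oplus>\<^bsub>Mat\<^esub> B) (i, j) \<otimes> v j) = (\<Oplus>j\<in>{..<n}. A (i, j) \<otimes> v j \<oplus> B (i, j) \<otimes> v j)"
      using assms that by (intro finsum_cong') (auto simp: mat_sp_simps(3) l_distr)
    thus ?thesis using assms that by (subst (asm) finsum_addf) auto
  qed
  thus ?thesis by (auto simp: mat_vec_def vec_sp_simps(3)[of "restrict _ _"] fun_eq_iff)
qed

lemma mat_smult_app:
  assumes "A \<in> carrier Mat" "c \<in> carrier F" "v \<in> carrier V"
  shows "app (c \<odot>\<^bsub>Mat\<^esub> A) v = c \<odot>\<^bsub>V\<^esub> app A v"
proof -
  have "(\<Oplus>j\<in>{..<n}. (c \<odot>\<^bsub>Mat\<^esub> A) (i, j) \<otimes> v j) = c \<otimes> (\<Oplus>j\<in>{..<n}. A (i, j) \<otimes> v j)" if "i < n" for i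
  proof -
    have "(\<Oplus>j\<in>{..<n}. (c \<odot>\<^bsub>Mat\<^esub> A) (i, j) \<otimes> v j) = (\<Oplus>j\<in>{..<n}. c \<otimes> (A (i, j) \<otimes> v j))"
      using assms that by (intro finsum_cong') (auto simp: mat_sp_simps(4) m_assoc)
    thus ?thesis using assms that by (subst finsum_rdistr) auto
  qed
  thus ?thesis by (auto simp: mat_vec_def vec_sp_simps(4)[of _ "restrict _ _"] fun_eq_iff)
qed

lemma app_module_hom: "A \<in> carrier Mat \<Longrightarrow> app A \<in> module_hom F V V"
  unfolding module_hom_def using app_add app_smult by auto

lemma app_mod_hom: "A \<in> carrier Mat \<Longrightarrow> mod_hom F V V (app A)"
  using app_module_hom V.module_axioms by (simp add: mod_hom_def mod_hom_axioms_def)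

section \<open>Columns, kernels and rank\<close>

definition unit_vec :: "nat \<Rightarrow> nat \<Rightarrow> 'a" where
  "unit_vec j = (\<lambda>i\<in>{..<n}. if i = j then \<one> else \<zero>)"

lemma unit_vec_closed: "unit_vec j \<in> carrier V"
  unfolding unit_vec_def vec_sp_simps by auto

lemma app_unit_vec:
  assumes "A \<in> carrier Mat" "j < n"
  shows "app A (unit_vec j) = mat_col n A j"
proof -
  have "(\<Oplus>k\<in>{..<n}. A (i, k) \<otimes> unit_vec j k) = A (i, j)" if "i < n" for i
  proof -
    have "(\<Oplus>k\<in>{..<n}. A (i, k) \<otimes> unit_vec j k) = (\<Oplus>k\<in>{..<n}. if j = k then A (i, k) else \<zero>)"
      using assms that by (intro finsum_cong') (auto simp: unit_vec_def)
    thus ?thesis using assms that by (subst (asm) finsum_singleton) auto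
  qed
  thus ?thesis by (auto simp: mat_vec_def mat_col_def fun_eq_iff)
qed

lemma app_in_submodule:
  assumes A: "A \<in> carrier Mat" and v: "v \<in> carrier V" and W: "submodule F W V"
    and cols: "mat_col n A ` {..<n} \<subseteq> W"
  shows "app A v \<in> W"
proof -
  \<comment> \<open>Truncating the product to the first k columns permits induction on k.\<close>
  have "k \<le> n \<Longrightarrow> (\<lambda>i\<in>{..<n}. \<Oplus>j\<in>{..<k}. A (i, j) \<otimes> v j) \<in> W" for k
  proof (induction k)
    case 0
    have "(\<lambda>i\<in>{..<n}. \<Oplus>j\<in>{..<0}. A (i, j) \<otimes> v j) = \<zero>\<^bsub>V\<^esub>" by (simp add: vec_sp_simps)
    thus ?case using submodule.zero_closed[OF W] by simp
  next
    case (Suc k)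
    have "(\<lambda>i\<in>{..<n}. \<Oplus>j\<in>{..<Suc k}. A (i, j) \<otimes> v j) =
        v k \<odot>\<^bsub>V\<^esub> mat_col n A k \<oplus>\<^bsub>V\<^esub> (\<lambda>i\<in>{..<n}. \<Oplus>j\<in>{..<k}. A (i, j) \<otimes> v j)"
    proof -
      have "(\<Oplus>j\<in>{..<Suc k}. A (i, j) \<otimes> v j) = v k \<otimes> A (i, k) \<oplus> (\<Oplus>j\<in>{..<k}. A (i, j) \<otimes> v j)"
        if "i < n" for i
      proof -
        have "(\<lambda>j. A (i, j) \<otimes> v j) \<in> {..<k} \<rightarrow> carrier F" using A v that Suc by auto
        moreover have "A (i, k) \<otimes> v k = v k \<otimes> A (i, k)" using A v that Suc by (intro m_comm) auto
        moreover have "A (i, k) \<otimes> v k \<in> carrier F" using A v that Suc by auto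
        ultimately show ?thesis unfolding lessThan_Suc by (subst finsum_insert) auto
      qed
      thus ?thesis by (auto simp: vec_sp_simps(3,4) mat_col_def fun_eq_iff)
    qed
    moreover have "v k \<odot>\<^bsub>V\<^esub> mat_col n A k \<in> W"
    proof (rule submodule.smult_closed[OF W])
      show "v k \<in> carrier F" "mat_col n A k \<in> W" using v cols Suc by auto
    qed
    moreover note Suc.IH[OF Suc_leD[OF Suc.prems]]
    ultimately show ?case by (simp only: submodule.m_closed[OF W])
  qed
  thus ?thesis unfolding mat_vec_def by simp
qed

definition nonsingular :: "(nat \<times> nat \<Rightarrow> 'a) \<Rightarrow> bool" where
  "nonsingular A \<longleftrightarrow> (\<forall>v\<in>carrier V. app A v = \<zero>\<^bsub>V\<^esub> \<longrightarrow> v = \<zero>\<^bsub>V\<^esub>)"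

lemma module_hom_inj_on:
  assumes T: "T \<in> module_hom F V V" and ker: "\<And>v. v \<in> carrier V \<Longrightarrow> T v = \<zero>\<^bsub>V\<^esub> \<Longrightarrow> v = \<zero>\<^bsub>V\<^esub>"
  shows "inj_on T (carrier V)"
proof -
  interpret T: mod_hom F V V T using T V.module_axioms by (simp add: mod_hom_def mod_hom_axioms_def)
  show ?thesis
  proof (rule inj_onI)
    fix u v assume *: "u \<in> carrier V" "v \<in> carrier V" "T u = T v"
    hence "T (u \<ominus>\<^bsub>V\<^esub> v) = \<zero>\<^bsub>V\<^esub>" by (simp add: V.M.r_neg a_minus_def)
    hence "u \<ominus>\<^bsub>V\<^esub> v = \<zero>\<^bsub>V\<^esub>" using * ker[of "u \<ominus>\<^bsub>V\<^esub> v"] by simp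
    thus "u = v" using * by simp
  qed
qed

lemma nonsingular_iff_inj: "A \<in> carrier Mat \<Longrightarrow> nonsingular A \<longleftrightarrow> inj_on (app A) (carrier V)"
proof
  assume A: "A \<in> carrier Mat" and inj: "inj_on (app A) (carrier V)"
  interpret A: mod_hom F V V "app A" by (rule app_mod_hom[OF A])
  have "app A \<zero>\<^bsub>V\<^esub> = \<zero>\<^bsub>V\<^esub>" by (rule A.f0_is_0)
  thus "nonsingular A" unfolding nonsingular_def using inj by (metis inj_onD V.M.zero_closed)
qed (auto simp: nonsingular_def intro!: module_hom_inj_on app_module_hom)

text \<open>On a finite space, injective and surjective self-maps coincide by the pigeonhole
  principle.\<close>

lemma nonsingular_iff_surj:
  assumes "A \<in> carrier Mat"
  shows "nonsingular A \<longleftrightarrow> app A ` carrier V = carrier V"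
  unfolding nonsingular_iff_inj[OF assms]
  using assms V.finite_vectors
  by (metis app_closed endo_inj_surj finite_surj_inj image_subsetI order_refl)

text \<open>The column span is the image of A and has q^rank elements, so full rank means
  surjectivity.\<close>

lemma mat_rank_ge_iff_nonsingular:
  assumes A: "A \<in> carrier Mat"
  shows "mat_rank F n n A \<ge> n \<longleftrightarrow> nonsingular A"
proof -
  let ?C = "mat_col n A ` {..<n}"
  interpret A: mod_hom F V V "app A" by (rule app_mod_hom[OF A])
  have cols: "?C \<subseteq> app A ` carrier V"
    using app_unit_vec[OF A, symmetric] unit_vec_closed by auto
  hence CV: "?C \<subseteq> carrier V" using A by auto
  have S: "submodule F (V.span ?C) V" by (rule V.span_is_submodule[OF CV])
  have im: "submodule F (app A ` carrier V) V" using A.im_is_submodule by (simp add: A.im_def)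
  have "V.span ?C = app A ` carrier V"
  proof
    show "V.span ?C \<subseteq> app A ` carrier V" by (rule V.span_is_subset[OF cols im])
    show "app A ` carrier V \<subseteq> V.span ?C"
      using app_in_submodule[OF A _ S] V.in_own_span[OF CV] by auto
  qed
  hence card: "card (app A ` carrier V) = q ^ mat_rank F n n A"
    using V.card_subspace[OF S] unfolding mat_rank_def by simp
  have "app A ` carrier V \<subseteq> carrier V" using A by auto
  hence "app A ` carrier V = carrier V \<longleftrightarrow> card (carrier V) \<le> card (app A ` carrier V)"
    using V.finite_vectors by (metis card_seteq order_refl)
  also have "\<dots> \<longleftrightarrow> n \<le> mat_rank F n n A"
    unfolding card card_V using V.two_le_card_scalars by (simp add: power_increasing_iff)
  finally show ?thesis using nonsingular_iff_surj[OF A] by simp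
qed

section \<open>Counting matrices by their values on independent vectors\<close>

lemma list_span_eq_carrier:
  assumes "V.list_indpt xs" "length xs = n"
  shows "V.list_span xs = carrier V"
  using V.card_list_span[OF assms(1)] assms(2) card_V V.list_span_carrier[OF V.list_indpt_carrier[OF assms(1)]]
  by (intro card_subset_eq V.finite_vectors) auto

lemma length_list_indpt:
  assumes "V.list_indpt xs"
  shows "length xs \<le> n"
proof -
  have "card (V.list_span xs) \<le> card (carrier V)"
    using V.list_span_carrier[OF V.list_indpt_carrier[OF assms]] by (intro card_mono V.finite_vectors)
  thus ?thesis
    unfolding V.card_list_span[OF assms] card_V using V.two_le_card_scalars by (simp add: power_increasing_iff)
qed

lemma card_list_indpt_extensions:
  assumes "V.list_indpt xs"
  shows "finite {ys. length ys = k \<and> V.list_indpt (ys @ xs)}"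
    "real (card {ys. length ys = k \<and> V.list_indpt (ys @ xs)}) = (\<Prod>i<k. real q ^ n - real q ^ (length xs + i))"
proof -
  have "{ys. length ys = k \<and> V.list_indpt (ys @ xs)} =
    {ys. length ys = k \<and> set ys \<subseteq> carrier V \<and> V.list_indpt (ys @ xs)}"
    using V.list_indpt_carrier by fastforce
  moreover have "submodule F (carrier V) V" by unfold_locales auto
  ultimately show "finite {ys. length ys = k \<and> V.list_indpt (ys @ xs)}"
    "real (card {ys. length ys = k \<and> V.list_indpt (ys @ xs)}) = (\<Prod>i<k. real q ^ n - real q ^ (length xs + i))"
    using V.card_indpt_extensions[of "carrier V" xs k] assms V.list_indpt_carrier[OF assms] card_V by auto
qed

text \<open>Existence by counting: the number of extensions is a product of factors q^n - q^j with j
  < n, none of which vanishes.\<close>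

lemma extend_to_basis:
  assumes "V.list_indpt xs"
  obtains ys where "V.list_indpt (ys @ xs)" "length (ys @ xs) = n"
proof -
  let ?k = "n - length xs"
  have "(\<Prod>i<?k. real q ^ n - real q ^ (length xs + i)) \<noteq> 0"
    using V.two_le_card_scalars by auto
  hence "{ys. length ys = ?k \<and> V.list_indpt (ys @ xs)} \<noteq> {}"
    using card_list_indpt_extensions(2)[OF assms, of ?k] by fastforce
  thus ?thesis using that length_list_indpt[OF assms] by auto
qed

text \<open>Linear maps that agree on a basis are equal; surjectivity follows because both sets have
  q^(n * n) elements.\<close>

lemma bij_betw_basis_images:
  assumes xs: "V.list_indpt xs" "length xs = n"
  shows "bij_betw (\<lambda>A. map (app A) xs) (carrier Mat) {ys. set ys \<subseteq> carrier V \<and> length ys = n}"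
proof -
  note xsV = V.list_indpt_carrier[OF xs(1)]
  have inj: "inj_on (\<lambda>A. map (app A) xs) (carrier Mat)"
  proof (rule inj_onI)
    fix A B assume AB: "A \<in> carrier Mat" "B \<in> carrier Mat" "map (app A) xs = map (app B) xs"
    interpret A: mod_hom F V V "app A" by (rule app_mod_hom[OF AB(1)])
    interpret B: mod_hom F V V "app B" by (rule app_mod_hom[OF AB(2)])
    have "submodule F {v \<in> carrier V. app A v = app B v} V" by unfold_locales auto
    hence "V.list_span xs \<subseteq> {v \<in> carrier V. app A v = app B v}"
      using AB xsV by (intro V.list_span_least) (auto simp: map_eq_conv)
    hence "app A (unit_vec j) = app B (unit_vec j)" for j
      using list_span_eq_carrier[OF xs] unit_vec_closed by auto
    hence col: "mat_col n A j = mat_col n B j" if "j < n" for j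
      using app_unit_vec[OF AB(1) that] app_unit_vec[OF AB(2) that] by simp
    have "A (i, j) = B (i, j)" if "i < n" "j < n" for i j
      using fun_cong[OF col[OF that(2)], of i] that by (simp add: mat_col_def)
    thus "A = B" using AB(1,2) unfolding mat_sp_simps by (intro PiE_ext) auto
  qed
  have sub: "(\<lambda>A. map (app A) xs) ` carrier Mat \<subseteq> {ys. set ys \<subseteq> carrier V \<and> length ys = n}"
    using xsV by (auto simp: xs(2) intro!: app_closed)
  have "card {ys. set ys \<subseteq> carrier V \<and> length ys = n} = card (carrier Mat)"
    using card_lists_length_eq[OF V.finite_vectors, of n] card_V card_Mat by (simp add: power_mult)
  hence "(\<lambda>A. map (app A) xs) ` carrier Mat = {ys. set ys \<subseteq> carrier V \<and> length ys = n}"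
    using card_image[OF inj] by (intro card_subset_eq[OF _ sub] finite_lists_length_eq V.finite_vectors) auto
  thus ?thesis using inj by (simp add: bij_betw_def)
qed

text \<open>After an extension to a basis, the values on the n - length xs new vectors are free,
  with q^n choices each.\<close>

lemma card_prescribed_images:
  assumes xs: "V.list_indpt xs" and ws: "length ws = length xs" "set ws \<subseteq> carrier V"
  shows "card {A \<in> carrier Mat. map (app A) xs = ws} = q ^ (n * (n - length xs))"
proof -
  obtain ys where ys: "V.list_indpt (ys @ xs)" "length (ys @ xs) = n" using extend_to_basis[OF xs] .
  let ?L = "{zs. set zs \<subseteq> carrier V \<and> length zs = n}"
  let ?g = "\<lambda>A. map (app A) (ys @ xs)"
  have bij: "bij_betw ?g (carrier Mat) ?L" by (rule bij_betw_basis_images[OF ys])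
  have "bij_betw ?g {A \<in> carrier Mat. map (app A) xs = ws}
     ((\<lambda>us. us @ ws) ` {us. set us \<subseteq> carrier V \<and> length us = length ys})"
  proof (rule bij_betw_imageI)
    show "inj_on ?g {A \<in> carrier Mat. map (app A) xs = ws}"
      using bij by (auto simp: bij_betw_def intro: inj_on_subset)
    show "?g ` {A \<in> carrier Mat. map (app A) xs = ws} =
       (\<lambda>us. us @ ws) ` {us. set us \<subseteq> carrier V \<and> length us = length ys}" (is "?l = ?r")
    proof
      show "?l \<subseteq> ?r"
      proof
        fix z assume "z \<in> ?l"
        then obtain A where A: "A \<in> carrier Mat" "map (app A) xs = ws" "z = map (app A) ys @ ws" by auto
        have "set (map (app A) ys) \<subseteq> carrier V"
          using A V.list_indpt_carrier[OF ys(1)] by auto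
        thus "z \<in> ?r" using A by auto
      qed
      show "?r \<subseteq> ?l"
      proof
        fix z assume "z \<in> ?r"
        then obtain us where us: "z = us @ ws" "set us \<subseteq> carrier V" "length us = length ys" by auto
        hence "z \<in> ?L" using ws ys by auto
        then obtain A where A: "A \<in> carrier Mat" "z = ?g A" using bij unfolding bij_betw_def by blast
        thus "z \<in> ?l" using us by auto
      qed
    qed
  qed
  hence "card {A \<in> carrier Mat. map (app A) xs = ws} = card ((\<lambda>us. us @ ws) ` {us. set us \<subseteq> carrier V \<and> length us = length ys})"
    by (rule bij_betw_same_card)
  also have "\<dots> = card {us. set us \<subseteq> carrier V \<and> length us = length ys}"
    by (rule card_image) (auto simp: inj_on_def)
  also have "\<dots> = card (carrier V) ^ length ys" by (rule card_lists_length_eq[OF V.finite_vectors])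
  also have "\<dots> = q ^ (n * (n - length xs))" 
  proof -
    have "n - length xs = length ys" using ys(2) by simp
    thus ?thesis by (simp add: card_V power_mult)
  qed
  finally show ?thesis .
qed

lemma list_span_map:
  assumes "T \<in> module_hom F V V" "set xs \<subseteq> carrier V"
  shows "V.list_span (map T xs) = T ` V.list_span xs"
proof -
  interpret T: mod_hom F V V T using assms V.module_axioms by (simp add: mod_hom_def mod_hom_axioms_def)
  show ?thesis using assms(2)
  proof (induction xs)
    case (Cons x xs)
    have *: "T (c \<odot>\<^bsub>V\<^esub> x \<oplus>\<^bsub>V\<^esub> w) = c \<odot>\<^bsub>V\<^esub> T x \<oplus>\<^bsub>V\<^esub> T w" if "c \<in> carrier F" "w \<in> V.list_span xs" for c w
      using that Cons V.list_span_carrier[of xs] by auto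
    show ?case
    proof
      show "V.list_span (map T (x # xs)) \<subseteq> T ` V.list_span (x # xs)"
        using Cons * by (auto simp: image_iff) metis
      show "T ` V.list_span (x # xs) \<subseteq> V.list_span (map T (x # xs))"
        using Cons * by auto blast
    qed
  qed simp
qed

lemma list_indpt_map:
  assumes "T \<in> module_hom F V V" "inj_on T (carrier V)" "V.list_indpt xs"
  shows "V.list_indpt (map T xs)"
proof -
  interpret T: mod_hom F V V T using assms V.module_axioms by (simp add: mod_hom_def mod_hom_axioms_def)
  show ?thesis using assms(3)
  proof (induction xs)
    case (Cons x xs)
    have xs: "set xs \<subseteq> carrier V" using Cons V.list_indpt_carrier by auto
    have "T x \<notin> T ` V.list_span xs"
      using Cons V.list_span_carrier[OF xs] assms(2) by (auto dest!: inj_onD)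
    thus ?case using Cons list_span_map[OF assms(1) xs] by auto
  qed simp
qed

text \<open>The nonsingular matrices are those that send a fixed basis to an independent list, so
  they correspond to ordered bases.\<close>

lemma card_nonsingular: "real (card {A \<in> carrier Mat. nonsingular A}) = gl_card (real q) n"
proof -
  obtain xs where xs: "V.list_indpt xs" "length xs = n" using extend_to_basis[of "[]"] by auto
  let ?g = "\<lambda>A. map (app A) xs"
  have bij: "bij_betw ?g (carrier Mat) {ys. set ys \<subseteq> carrier V \<and> length ys = n}"
    by (rule bij_betw_basis_images[OF xs])
  have iff: "V.list_indpt (?g A) \<longleftrightarrow> nonsingular A" if A: "A \<in> carrier Mat" for A
  proof
    assume "V.list_indpt (?g A)"
    hence "V.list_span (?g A) = carrier V" using list_span_eq_carrier xs by simp
    hence "app A ` carrier V = carrier V"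
      using list_span_map[OF app_module_hom[OF A] V.list_indpt_carrier[OF xs(1)]] list_span_eq_carrier[OF xs] by simp
    thus "nonsingular A" using nonsingular_iff_surj[OF A] by simp
  next
    assume "nonsingular A"
    thus "V.list_indpt (?g A)"
      using list_indpt_map[OF app_module_hom[OF A] _ xs(1)] nonsingular_iff_inj[OF A] by simp
  qed
  have "bij_betw ?g {A \<in> carrier Mat. nonsingular A} {ys. length ys = n \<and> V.list_indpt (ys @ [])}"
  proof (rule bij_betw_imageI)
    show "inj_on ?g {A \<in> carrier Mat. nonsingular A}"
      using bij by (auto simp: bij_betw_def intro: inj_on_subset)
    show "?g ` {A \<in> carrier Mat. nonsingular A} = {ys. length ys = n \<and> V.list_indpt (ys @ [])}"
    proof
      show "?g ` {A \<in> carrier Mat. nonsingular A} \<subseteq> {ys. length ys = n \<and> V.list_indpt (ys @ [])}"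
        using iff xs by auto
      show "{ys. length ys = n \<and> V.list_indpt (ys @ [])} \<subseteq> ?g ` {A \<in> carrier Mat. nonsingular A}"
      proof
        fix ys assume "ys \<in> {ys. length ys = n \<and> V.list_indpt (ys @ [])}"
        hence ys: "length ys = n" "V.list_indpt ys" by auto
        hence "ys \<in> {ys. set ys \<subseteq> carrier V \<and> length ys = n}" using V.list_indpt_carrier by auto
        then obtain A where "A \<in> carrier Mat" "ys = ?g A" using bij unfolding bij_betw_def by blast
        thus "ys \<in> ?g ` {A \<in> carrier Mat. nonsingular A}" using iff ys by auto
      qed
    qed
  qed
  hence "card {A \<in> carrier Mat. nonsingular A} = card {ys. length ys = n \<and> V.list_indpt (ys @ [])}"
    by (rule bij_betw_same_card)
  thus ?thesis using card_list_indpt_extensions(2)[of "[]" n] by (simp add: gl_card_def)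
qed

section \<open>Matrices and pencils without eigenvalues\<close>

text \<open>The kernel of \<open>M - c T\<close>, an eigenspace of \<open>M\<close> if \<open>T\<close> is the identity.\<close>

definition pencil_ker :: "((nat \<Rightarrow> 'a) \<Rightarrow> nat \<Rightarrow> 'a) \<Rightarrow> 'a \<Rightarrow> (nat \<times> nat \<Rightarrow> 'a) \<Rightarrow> (nat \<Rightarrow> 'a) set" where
  "pencil_ker T c M = {v \<in> carrier V. app M v = c \<odot>\<^bsub>V\<^esub> T v}"

lemma pencil_ker_submodule:
  assumes "T \<in> module_hom F V V" "c \<in> carrier F" "M \<in> carrier Mat"
  shows "submodule F (pencil_ker T c M) V"
proof -
  interpret T: mod_hom F V V T using assms V.module_axioms by (simp add: mod_hom_def mod_hom_axioms_def)
  interpret M: mod_hom F V V "app M" by (rule app_mod_hom[OF assms(3)])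
  show ?thesis
  proof
    show "pencil_ker T c M \<subseteq> carrier V" by (auto simp: pencil_ker_def)
    show "\<zero>\<^bsub>V\<^esub> \<in> pencil_ker T c M" using assms by (simp add: pencil_ker_def)
    show "v \<oplus>\<^bsub>V\<^esub> w \<in> pencil_ker T c M" if "v \<in> pencil_ker T c M" "w \<in> pencil_ker T c M" for v w
      using that assms by (simp add: pencil_ker_def V.smult_r_distr)
    show "d \<odot>\<^bsub>V\<^esub> v \<in> pencil_ker T c M" if "d \<in> carrier F" "v \<in> pencil_ker T c M" for d v
    proof -
      have "v \<in> carrier V" using that by (simp add: pencil_ker_def)
      thus ?thesis using that assms by (simp add: pencil_ker_def V.smult_assoc1[symmetric] m_comm)
    qed
  qed
qed

text \<open>Eigenvectors for distinct scalars are independent: on the span, M - c T acts as T after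
  each coordinate has been multiplied by a nonzero difference d - c.\<close>

lemma pencil_ker_inter_list_span:
  assumes T: "T \<in> module_hom F V V" "inj_on T (carrier V)" and c: "c \<in> carrier F" and M: "M \<in> carrier Mat"
    and ps: "V.list_indpt (map snd ps)"
      "\<And>d x. (d, x) \<in> set ps \<Longrightarrow> d \<in> carrier F \<and> d \<noteq> c \<and> app M x = d \<odot>\<^bsub>V\<^esub> T x"
  shows "pencil_ker T c M \<inter> V.list_span (map snd ps) \<subseteq> {\<zero>\<^bsub>V\<^esub>}"
proof -
  interpret T: mod_hom F V V T using T V.module_axioms by (simp add: mod_hom_def mod_hom_axioms_def)
  interpret M: mod_hom F V V "app M" by (rule app_mod_hom[OF M])
  \<comment> \<open>Claimed for every w in the span, because the tail s of a kernel vector need not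
    lie in the kernel.\<close>
  have "\<forall>w\<in>V.list_span (map snd ps). \<exists>w'\<in>V.list_span (map snd ps).
      app M w = c \<odot>\<^bsub>V\<^esub> T w \<oplus>\<^bsub>V\<^esub> T w' \<and> (w' = \<zero>\<^bsub>V\<^esub> \<longrightarrow> w = \<zero>\<^bsub>V\<^esub>)"
    using ps
  proof (induction ps)
    case Nil
    show ?case using c by simp
  next
    case (Cons p ps)
    obtain d x where p: "p = (d, x)" by (cases p)
    have d: "d \<in> carrier F" "d \<noteq> c" "app M x = d \<odot>\<^bsub>V\<^esub> T x" using Cons.prems(2)[of d x] p by auto
    have x: "x \<in> carrier V" "x \<notin> V.list_span (map snd ps)" "V.list_indpt (map snd ps)"
      using Cons.prems p by auto
    let ?S = "V.list_span (map snd ps)"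
    have S: "submodule F ?S V" by (rule V.list_span_submodule[OF V.list_indpt_carrier[OF x(3)]])
    have SV: "?S \<subseteq> carrier V" by (rule submodule.subset[OF S])
    show ?case
    proof
      fix w assume "w \<in> V.list_span (map snd (p # ps))"
      then obtain a s where as: "a \<in> carrier F" "s \<in> ?S" "w = a \<odot>\<^bsub>V\<^esub> x \<oplus>\<^bsub>V\<^esub> s" using p by auto
      obtain s' where s': "s' \<in> ?S" "app M s = c \<odot>\<^bsub>V\<^esub> T s \<oplus>\<^bsub>V\<^esub> T s'" "s' = \<zero>\<^bsub>V\<^esub> \<longrightarrow> s = \<zero>\<^bsub>V\<^esub>"
        using Cons.IH x(3) Cons.prems(2) as(2) by (metis list.set_intros(2))
      \<comment> \<open>The coordinate of x in w'.\<close>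
      define e where "e = a \<otimes> (d \<ominus> c)"
      have e: "e \<in> carrier F" using as c d by (simp add: e_def)
      have sV: "s \<in> carrier V" "s' \<in> carrier V" using SV as s' by auto
      let ?w' = "e \<odot>\<^bsub>V\<^esub> x \<oplus>\<^bsub>V\<^esub> s'"
      have "a \<otimes> d = c \<otimes> a \<oplus> e"
        unfolding e_def using as(1) c d(1) by algebra
      hence "(a \<otimes> d) \<odot>\<^bsub>V\<^esub> T x = (c \<otimes> a) \<odot>\<^bsub>V\<^esub> T x \<oplus>\<^bsub>V\<^esub> e \<odot>\<^bsub>V\<^esub> T x"
        using as c e x by (simp add: V.smult_l_distr)
      hence ax: "a \<odot>\<^bsub>V\<^esub> (d \<odot>\<^bsub>V\<^esub> T x) = c \<odot>\<^bsub>V\<^esub> (a \<odot>\<^bsub>V\<^esub> T x) \<oplus>\<^bsub>V\<^esub> e \<odot>\<^bsub>V\<^esub> T x"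
        using as c d x by (simp add: V.smult_assoc1)
      have "app M w = a \<odot>\<^bsub>V\<^esub> (d \<odot>\<^bsub>V\<^esub> T x) \<oplus>\<^bsub>V\<^esub> (c \<odot>\<^bsub>V\<^esub> T s \<oplus>\<^bsub>V\<^esub> T s')"
        using as x sV d s' by simp
      also have "\<dots> = (c \<odot>\<^bsub>V\<^esub> (a \<odot>\<^bsub>V\<^esub> T x) \<oplus>\<^bsub>V\<^esub> c \<odot>\<^bsub>V\<^esub> T s) \<oplus>\<^bsub>V\<^esub> (e \<odot>\<^bsub>V\<^esub> T x \<oplus>\<^bsub>V\<^esub> T s')"
        unfolding ax using as x sV d c e by (simp add: V.M.a_ac)
      also have "\<dots> = c \<odot>\<^bsub>V\<^esub> T w \<oplus>\<^bsub>V\<^esub> T ?w'"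
        using as x sV c e by (simp add: V.smult_r_distr)
      finally have 1: "app M w = c \<odot>\<^bsub>V\<^esub> T w \<oplus>\<^bsub>V\<^esub> T ?w'" .
      have 2: "w = \<zero>\<^bsub>V\<^esub>" if "?w' = \<zero>\<^bsub>V\<^esub>"
      proof -
        have "e = \<zero>"
          using V.indpt_coeff_zero[OF S x(1,2) e s'(1)] that submodule.zero_closed[OF S] by simp
        moreover have "d \<ominus> c \<noteq> \<zero>" "d \<ominus> c \<in> carrier F" using d c by auto
        ultimately have a0: "a = \<zero>" using as unfolding e_def by (metis integral_iff)
        have "s' = \<zero>\<^bsub>V\<^esub>" using that \<open>e = \<zero>\<close> sV x by simp
        thus ?thesis using s'(3) as(3) a0 x by simp
      qed
      have "?w' \<in> V.list_span (map snd (p # ps))" using e s' p by auto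
      thus "\<exists>w'\<in>V.list_span (map snd (p # ps)). app M w = c \<odot>\<^bsub>V\<^esub> T w \<oplus>\<^bsub>V\<^esub> T w' \<and> (w' = \<zero>\<^bsub>V\<^esub> \<longrightarrow> w = \<zero>\<^bsub>V\<^esub>)"
        using 1 2 by blast
    qed
  qed
  note * = this
  show ?thesis
  proof
    fix w assume w: "w \<in> pencil_ker T c M \<inter> V.list_span (map snd ps)"
    have span: "V.list_span (map snd ps) \<subseteq> carrier V"
      by (rule V.list_span_carrier[OF V.list_indpt_carrier[OF ps(1)]])
    obtain w' where w': "w' \<in> V.list_span (map snd ps)" "app M w = c \<odot>\<^bsub>V\<^esub> T w \<oplus>\<^bsub>V\<^esub> T w'" "w' = \<zero>\<^bsub>V\<^esub> \<longrightarrow> w = \<zero>\<^bsub>V\<^esub>"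
      using * w by blast
    have V: "w \<in> carrier V" "w' \<in> carrier V" using w w' span by auto
    \<comment> \<open>On the kernel M w = c T w, so T w' = 0 and injectivity of T gives w' =
      0.\<close>
    have "c \<odot>\<^bsub>V\<^esub> T w \<oplus>\<^bsub>V\<^esub> T w' = c \<odot>\<^bsub>V\<^esub> T w \<oplus>\<^bsub>V\<^esub> \<zero>\<^bsub>V\<^esub>"
      using w w'(2) V c by (simp add: pencil_ker_def)
    hence "T w' = T \<zero>\<^bsub>V\<^esub>" using V c by (simp only: V.M.add.l_cancel T.f_im V.smult_closed V.M.zero_closed T.f0_is_0)
    hence "w' = \<zero>\<^bsub>V\<^esub>" using T(2) V by (meson inj_onD V.M.zero_closed)
    thus "w \<in> {\<zero>\<^bsub>V\<^esub>}" using w' by simp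
  qed
qed

section \<open>Counting pencils without eigenvalues in a given set\<close>

lemma q_gt_1: "real q > 1"
  using V.two_le_card_scalars by simp

text \<open>Moebius inversion for d = dim W. Since d \<le> n, the range k \<le> n serves every W at
  once, so the sum can be exchanged with one over matrices.\<close>

lemma fps_ker_detects_trivial_submodule:
  assumes W: "submodule F W V"
  shows "(\<Sum>k\<le>n. fps_nth (fps_ker (real q)) k * real (card {ys. length ys = k \<and> set ys \<subseteq> W \<and> V.list_indpt ys})) =
    (if W = {\<zero>\<^bsub>V\<^esub>} then 1 else 0)"
proof -
  define d where "d = vectorspace.dim F (V\<lparr>carrier := W\<rparr>)"
  have card: "card W = q ^ d" unfolding d_def by (rule V.card_subspace[OF W])
  have WV: "W \<subseteq> carrier V" by (rule submodule.subset[OF W])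
  have "q ^ d \<le> q ^ n" unfolding card[symmetric] card_V[symmetric]
    by (rule card_mono[OF V.finite_vectors WV])
  hence "d \<le> n" using V.two_le_card_scalars by (simp add: power_increasing_iff)
  have "d = 0 \<longleftrightarrow> card W = 1" using card V.two_le_card_scalars by auto
  also have "\<dots> \<longleftrightarrow> W = {\<zero>\<^bsub>V\<^esub>}" using submodule.zero_closed[OF W] by (auto simp: card_1_singleton_iff)
  finally have d0: "d = 0 \<longleftrightarrow> W = {\<zero>\<^bsub>V\<^esub>}" .
  have "real (card {ys. length ys = k \<and> set ys \<subseteq> W \<and> V.list_indpt ys}) = (\<Prod>i<k. real q ^ d - real q ^ i)" for k
    using V.card_indpt_extensions[OF W, of "[]" k] card by simp
  thus ?thesis
    using alternating_sum_qfac_power[OF q_gt_1 \<open>d \<le> n\<close>] d0 by (simp add: fps_ker_def)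
qed

text \<open>The prescribed vectors form a list of pairs because one scalar may own several
  independent vectors.\<close>

definition pencil_free :: "((nat \<Rightarrow> 'a) \<Rightarrow> nat \<Rightarrow> 'a) \<Rightarrow> ('a \<times> (nat \<Rightarrow> 'a)) list \<Rightarrow> 'a set \<Rightarrow> (nat \<times> nat \<Rightarrow> 'a) set" where
  "pencil_free T ps S = {M \<in> carrier Mat. (\<forall>(d, x)\<in>set ps. x \<in> pencil_ker T d M) \<and> (\<forall>c\<in>S. pencil_ker T c M = {\<zero>\<^bsub>V\<^esub>})}"

text \<open>Prescribing the eigenvectors \<open>ps\<close> is what makes the induction on the set of forbidden scalars work.\<close>

lemma card_pencil_free:
  assumes T: "T \<in> module_hom F V V" "inj_on T (carrier V)"
    and "finite S" "S \<subseteq> carrier F"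
    and "V.list_indpt (map snd ps)" "\<forall>(d, x)\<in>set ps. d \<in> carrier F - S"
  shows "real (card (pencil_free T ps S)) * (\<Prod>i<length ps. real q ^ n - real q ^ i) =
    gl_card (real q) n * fps_nth (fps_ker (real q) ^ card S * fps_mat (real q)) (n - length ps)"
  using assms(3-)
proof (induction S arbitrary: ps rule: finite_induct)
  case empty
  interpret T: mod_hom F V V T using T V.module_axioms by (simp add: mod_hom_def mod_hom_axioms_def)
  let ?ws = "map (\<lambda>(d, x). d \<odot>\<^bsub>V\<^esub> T x) ps"
  have psV: "x \<in> carrier V" if "(d, x) \<in> set ps" for d x
    using V.list_indpt_carrier[OF empty(2)] that by force
  \<comment> \<open>With no forbidden scalar, only linear conditions on independent vectors
    remain.\<close>
  have "pencil_free T ps {} = {M \<in> carrier Mat. map (app M) (map snd ps) = ?ws}"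
    unfolding pencil_free_def pencil_ker_def using psV by (auto simp: map_eq_conv case_prod_unfold)
  also have "card \<dots> = q ^ (n * (n - length ps))"
  proof -
    have "set ?ws \<subseteq> carrier V" using psV empty(3) by auto
    thus ?thesis using card_prescribed_images[OF empty(2), of ?ws] by simp
  qed
  finally show ?case
    using gl_card_partial[OF q_gt_1, of "length ps" n] length_list_indpt[OF empty(2)] by simp
next
  case (insert c S)
  let ?K = "length ps" and ?b = "fps_nth (fps_ker (real q))"
  let ?X = "pencil_free T ps S" and ?xs = "map snd ps"
  define A where "A = (\<lambda>k M. {ys. length ys = k \<and> set ys \<subseteq> pencil_ker T c M \<and> V.list_indpt ys})"
  define Y where "Y = (\<lambda>k. {ys. length ys = k \<and> V.list_indpt (ys @ ?xs)})"
  have c: "c \<in> carrier F" using insert by auto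
  have K: "?K \<le> n" using length_list_indpt[OF insert.prems(2)] by simp
  have finX: "finite ?X" unfolding pencil_free_def using Mat.finite_vectors by auto
  have finA: "finite (A k M)" if "M \<in> carrier Mat" for k M
    unfolding A_def using V.card_indpt_extensions[OF pencil_ker_submodule[OF T(1) c that], of "[]" k] by simp
  have finY: "finite (Y k)" for k
    unfolding Y_def by (rule card_list_indpt_extensions(1)[OF insert.prems(2)])
  have split: "pencil_free T ps (insert c S) = {M \<in> ?X. pencil_ker T c M = {\<zero>\<^bsub>V\<^esub>}}"
    unfolding pencil_free_def by auto
  have "real (card (pencil_free T ps (insert c S))) = (\<Sum>M\<in>?X. if pencil_ker T c M = {\<zero>\<^bsub>V\<^esub>} then 1 else 0)"
    unfolding split using finX by (simp add: sum.If_cases Collect_conj_eq Int_commute)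
  also have "\<dots> = (\<Sum>M\<in>?X. \<Sum>k\<le>n. ?b k * real (card (A k M)))"
  proof (rule sum.cong)
    fix M assume "M \<in> ?X"
    hence "M \<in> carrier Mat" by (simp add: pencil_free_def)
    thus "(if pencil_ker T c M = {\<zero>\<^bsub>V\<^esub>} then 1 else 0) = (\<Sum>k\<le>n. ?b k * real (card (A k M)))"
      unfolding A_def using fps_ker_detects_trivial_submodule[OF pencil_ker_submodule[OF T(1) c]] by simp
  qed simp
  also have "\<dots> = (\<Sum>k\<le>n. ?b k * (\<Sum>M\<in>?X. real (card (A k M))))"
    by (subst sum.swap) (simp add: sum_distrib_left)
  also have "\<dots> = (\<Sum>k\<le>n. ?b k * (\<Sum>ys\<in>Y k. real (card (pencil_free T (map (Pair c) ys @ ps) S))))"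
  proof (intro sum.cong refl arg_cong2[where f = "(*)"])
    fix k
    \<comment> \<open>Double counting: choosing the tuple before the matrix amounts to prescribing k
      further eigenvectors for c.\<close>
    have sw: "(SIGMA M:?X. A k M) = (\<lambda>(ys, M). (M, ys)) ` (SIGMA ys:Y k. pencil_free T (map (Pair c) ys @ ps) S)"
    proof -
      have "M \<in> ?X \<and> ys \<in> A k M \<longleftrightarrow> ys \<in> Y k \<and> M \<in> pencil_free T (map (Pair c) ys @ ps) S" for M ys
      proof
        assume *: "M \<in> ?X \<and> ys \<in> A k M"
        hence M: "M \<in> carrier Mat" and eig: "\<forall>(d, x)\<in>set ps. x \<in> pencil_ker T d M" by (auto simp: pencil_free_def)
        have ys: "set ys \<subseteq> pencil_ker T c M" "V.list_indpt ys" "length ys = k" using * by (auto simp: A_def)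
        have sub: "V.list_span ys \<subseteq> pencil_ker T c M"
          by (rule V.list_span_least[OF pencil_ker_submodule[OF T(1) c M] ys(1)])
        \<comment> \<open>Independence from the vectors already prescribed is automatic, since those
          belong to scalars other than c.\<close>
        have "pencil_ker T c M \<inter> V.list_span ?xs \<subseteq> {\<zero>\<^bsub>V\<^esub>}"
          using eig insert.prems(3) by (intro pencil_ker_inter_list_span[OF T c M insert.prems(2)])
            (auto simp: pencil_ker_def)
        hence "V.list_indpt (ys @ ?xs)"
          using sub by (intro V.list_indpt_append ys insert.prems) auto
        thus "ys \<in> Y k \<and> M \<in> pencil_free T (map (Pair c) ys @ ps) S"
          using * ys by (auto simp: Y_def pencil_free_def)
      next
        assume *: "ys \<in> Y k \<and> M \<in> pencil_free T (map (Pair c) ys @ ps) S"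
        hence "V.list_indpt (ys @ ?xs)" by (simp add: Y_def)
        from V.list_indpt_appendD(1)[OF this] show "M \<in> ?X \<and> ys \<in> A k M"
          using * by (auto simp: Y_def pencil_free_def A_def)
      qed
      note iff = this
      show ?thesis by (auto simp: image_iff iff[symmetric]) (use iff in blast)+
    qed
    have "(\<Sum>M\<in>?X. card (A k M)) = card (SIGMA M:?X. A k M)"
      using finX finA by (subst card_SigmaI) (auto simp: pencil_free_def)
    also have "\<dots> = card (SIGMA ys:Y k. pencil_free T (map (Pair c) ys @ ps) S)"
      unfolding sw by (rule card_image) (auto simp: inj_on_def)
    also have "\<dots> = (\<Sum>ys\<in>Y k. card (pencil_free T (map (Pair c) ys @ ps) S))"
      using finY Mat.finite_vectors by (subst card_SigmaI) (auto simp: pencil_free_def)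
    finally show "(\<Sum>M\<in>?X. real (card (A k M))) = (\<Sum>ys\<in>Y k. real (card (pencil_free T (map (Pair c) ys @ ps) S)))"
      by (simp only: of_nat_sum[symmetric])
  qed
  finally have count: "real (card (pencil_free T ps (insert c S))) =
    (\<Sum>k\<le>n. ?b k * (\<Sum>ys\<in>Y k. real (card (pencil_free T (map (Pair c) ys @ ps) S))))" .
  have each: "(\<Sum>ys\<in>Y k. real (card (pencil_free T (map (Pair c) ys @ ps) S))) * (\<Prod>i<?K. real q ^ n - real q ^ i) =
    (if k \<le> n - ?K then gl_card (real q) n * fps_nth (fps_ker (real q) ^ card S * fps_mat (real q)) (n - ?K - k) else 0)" for k
  proof (cases "Y k = {}")
    case False
    then obtain zs where zs: "zs \<in> Y k" by auto
    hence k: "k \<le> n - ?K" using length_list_indpt[of "zs @ ?xs"] by (auto simp: Y_def)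
    \<comment> \<open>The product for K + k vectors is the one for K vectors times the number of
      extensions. By induction all extensions contribute equally, so this number cancels.\<close>
    define P where "P = (\<Prod>i<?K + k. real q ^ n - real q ^ i)"
    have P: "P = (\<Prod>i<?K. real q ^ n - real q ^ i) * real (card (Y k))"
      unfolding P_def Y_def card_list_indpt_extensions(2)[OF insert.prems(2)] by (simp add: prod_lessThan_add)
    have IH: "real (card (pencil_free T (map (Pair c) ys @ ps) S)) * P =
      gl_card (real q) n * fps_nth (fps_ker (real q) ^ card S * fps_mat (real q)) (n - ?K - k)" if ys: "ys \<in> Y k" for ys
    proof -
      have "map snd (map (Pair c) ys @ ps) = ys @ ?xs" by (simp add: comp_def)
      moreover have "length (map (Pair c) ys @ ps) = ?K + k" using ys by (simp add: Y_def)
      moreover have "V.list_indpt (ys @ ?xs)" using ys by (simp add: Y_def)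
      moreover have "\<forall>(d, x)\<in>set (map (Pair c) ys @ ps). d \<in> carrier F - S"
        using insert.prems(3) insert.hyps c by auto
      ultimately show ?thesis
        using insert.IH[of "map (Pair c) ys @ ps"] insert.prems(1) by (simp add: P_def add.commute)
    qed
    have cardY: "real (card (Y k)) > 0" using zs finY[of k] by (auto simp: card_gt_0_iff)
    have "real (card (Y k)) * ((\<Sum>ys\<in>Y k. real (card (pencil_free T (map (Pair c) ys @ ps) S))) * (\<Prod>i<?K. real q ^ n - real q ^ i)) =
      (\<Sum>ys\<in>Y k. real (card (pencil_free T (map (Pair c) ys @ ps) S)) * P)"
      unfolding P by (simp add: sum_distrib_left sum_distrib_right mult_ac)
    also have "\<dots> = real (card (Y k)) * (gl_card (real q) n * fps_nth (fps_ker (real q) ^ card S * fps_mat (real q)) (n - ?K - k))"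
      using IH by simp
    finally show ?thesis using cardY k by simp
  next
    case True
    have "k > n - ?K"
    proof (rule ccontr)
      assume "\<not> k > n - ?K"
      hence "(\<Prod>i<k. real q ^ n - real q ^ (length ?xs + i)) \<noteq> 0"
        using q_gt_1 K by auto
      hence "real (card (Y k)) \<noteq> 0"
        unfolding Y_def card_list_indpt_extensions(2)[OF insert.prems(2)] .
      thus False using True by simp
    qed
    thus ?thesis using True by simp
  qed
  have "real (card (pencil_free T ps (insert c S))) * (\<Prod>i<?K. real q ^ n - real q ^ i) =
    (\<Sum>k\<le>n. ?b k * ((\<Sum>ys\<in>Y k. real (card (pencil_free T (map (Pair c) ys @ ps) S))) * (\<Prod>i<?K. real q ^ n - real q ^ i)))"
    unfolding count by (subst sum_distrib_right) (simp only: mult.assoc)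
  also have "\<dots> = (\<Sum>k\<le>n - ?K. ?b k * (gl_card (real q) n * fps_nth (fps_ker (real q) ^ card S * fps_mat (real q)) (n - ?K - k)))"
    unfolding each by (rule sum.mono_neutral_cong_right) auto
  \<comment> \<open>The sum over k is a convolution, so the scalar c contributes one more factor
    B.\<close>
  also have "\<dots> = gl_card (real q) n * fps_nth (fps_ker (real q) * (fps_ker (real q) ^ card S * fps_mat (real q))) (n - ?K)"
    unfolding fps_mult_nth[of "fps_ker (real q)"] atLeast0AtMost by (simp add: sum_distrib_left mult_ac)
  finally show ?case using insert.hyps by (simp add: mult_ac)
qed

lemma card_pencil_free_all:
  assumes "T \<in> module_hom F V V" "inj_on T (carrier V)"
  shows "real (card (pencil_free T [] (carrier F))) =
    gl_card (real q) n * (\<Sum>k\<le>n. fps_nth (fps_ker (real q) ^ (q - 1)) k)"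
proof -
  \<comment> \<open>Forbidding all q scalars gives B^q, of which one factor is spent on
    \<open>fps_mat\<close>.\<close>
  have "Suc (q - 1) = q" using V.two_le_card_scalars by simp
  thus ?thesis
    using card_pencil_free[OF assms finite_carrier, of "[]"] fps_ker_power_times_mat_nth[OF q_gt_1, of "q - 1" n] by simp
qed

definition no_eigenvalue :: "(nat \<times> nat \<Rightarrow> 'a) set" where
  "no_eigenvalue = {A \<in> carrier Mat. \<not> (\<exists>c. mat_eigenvalue F n A c)}"

lemma no_eigenvalue_eq: "no_eigenvalue = pencil_free (\<lambda>v. v) [] (carrier F)"
proof -
  have "\<zero>\<^bsub>V\<^esub> \<in> pencil_ker (\<lambda>v. v) c A" if "c \<in> carrier F" "A \<in> carrier Mat" for c A
    using pencil_ker_submodule[of "\<lambda>v. v" c A] that by (auto simp: module_hom_def intro: submodule.zero_closed)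
  thus ?thesis unfolding no_eigenvalue_def pencil_free_def mat_eigenvalue_def pencil_ker_def by auto
qed

lemma card_no_eigenvalue:
  "real (card no_eigenvalue) = gl_card (real q) n * (\<Sum>k\<le>n. fps_nth (fps_ker (real q) ^ (q - 1)) k)"
  unfolding no_eigenvalue_eq by (rule card_pencil_free_all) (auto simp: module_hom_def)

text \<open>The formula in \<open>card_pencil_free_all\<close> is the same for every injective T, in
  particular for the identity.\<close>

lemma card_pencil_free_app:
  assumes "A \<in> carrier Mat" "nonsingular A"
  shows "card (pencil_free (app A) [] (carrier F)) = card no_eigenvalue"
proof -
  have "real (card (pencil_free (app A) [] (carrier F))) = real (card no_eigenvalue)"
    using assms unfolding card_no_eigenvalue
    by (intro card_pencil_free_all app_module_hom) (auto simp: nonsingular_iff_inj)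
  thus ?thesis by simp
qed

section \<open>Codes and their ordered bases\<close>

lemma rk_codes_eq:
  "rk_codes F n n 2 n = {C. submodule F C Mat \<and> card C = q ^ 2 \<and> (\<forall>A\<in>C. A \<noteq> \<zero>\<^bsub>Mat\<^esub> \<longrightarrow> nonsingular A)}"
proof -
  have "subspace F C Mat \<and> vectorspace.dim F (Mat\<lparr>carrier := C\<rparr>) = 2 \<and> (\<forall>A\<in>C. A \<noteq> \<zero>\<^bsub>Mat\<^esub> \<longrightarrow> mat_rank F n n A \<ge> n) \<longleftrightarrow>
    submodule F C Mat \<and> card C = q ^ 2 \<and> (\<forall>A\<in>C. A \<noteq> \<zero>\<^bsub>Mat\<^esub> \<longrightarrow> nonsingular A)" for C
  proof (cases "submodule F C Mat")
    case True
    have "subspace F C Mat" using True by (simp add: subspace_def Mat.vectorspace_axioms)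
    moreover have "vectorspace.dim F (Mat\<lparr>carrier := C\<rparr>) = 2 \<longleftrightarrow> card C = q ^ 2"
      using Mat.card_subspace[OF True] Mat.two_le_card_scalars by (auto dest: power_inject_exp[THEN iffD1, rotated])
    moreover have "C \<subseteq> carrier Mat" by (rule submodule.subset[OF True])
    ultimately show ?thesis using True mat_rank_ge_iff_nonsingular by blast
  next
    case False
    thus ?thesis by (simp add: subspace_def)
  qed
  thus ?thesis unfolding rk_codes_def by blast
qed

definition code_bases :: "(nat \<times> nat \<Rightarrow> 'a) list set" where
  "code_bases = {zs. length zs = 2 \<and> Mat.list_indpt zs \<and> (\<forall>A\<in>Mat.list_span zs. A \<noteq> \<zero>\<^bsub>Mat\<^esub> \<longrightarrow> nonsingular A)}"

text \<open>A code with q^2 elements has (q^2 - 1) (q^2 - q) ordered bases, each of which recovers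
  the code as its span.\<close>

lemma card_code_bases:
  "real (card code_bases) = real (card (rk_codes F n n 2 n)) * ((real q ^ 2 - 1) * (real q ^ 2 - real q))"
proof -
  define L where "L = (\<lambda>C. {zs. length zs = 2 \<and> set zs \<subseteq> C \<and> Mat.list_indpt (zs @ [])})"
  let ?R = "rk_codes F n n 2 n"
  have cardX: "finite (L C)" "real (card (L C)) = (real q ^ 2 - 1) * (real q ^ 2 - real q)" if "C \<in> ?R" for C
  proof -
    have "submodule F C Mat" "card C = q ^ 2" using that by (auto simp: rk_codes_eq)
    thus "finite (L C)" "real (card (L C)) = (real q ^ 2 - 1) * (real q ^ 2 - real q)"
      using Mat.card_indpt_extensions[of C "[]" 2] by (auto simp: L_def numeral_2_eq_2)
  qed
  have span: "Mat.list_span zs = C" if "C \<in> ?R" "zs \<in> L C" for C zs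
  proof -
    have C: "submodule F C Mat" "card C = q ^ 2" using that by (auto simp: rk_codes_eq)
    have zs: "length zs = 2" "set zs \<subseteq> C" "Mat.list_indpt zs" using that by (auto simp: L_def)
    have "finite C" using submodule.subset[OF C(1)] Mat.finite_vectors finite_subset by blast
    thus ?thesis
      using Mat.list_span_least[OF C(1) zs(2)] Mat.card_list_span[OF zs(3)] zs(1) C(2)
      by (intro card_subset_eq) auto
  qed
  have "code_bases = snd ` (SIGMA C:?R. L C)"
  proof
    show "snd ` (SIGMA C:?R. L C) \<subseteq> code_bases"
      using span by (auto simp: code_bases_def L_def rk_codes_eq)
    show "code_bases \<subseteq> snd ` (SIGMA C:?R. L C)"
    proof
      fix zs assume zs: "zs \<in> code_bases"
      hence V: "set zs \<subseteq> carrier Mat" using Mat.list_indpt_carrier by (auto simp: code_bases_def)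
      have "Mat.list_span zs \<in> ?R"
        using zs Mat.card_list_span[of zs] Mat.list_span_submodule[OF V] by (auto simp: rk_codes_eq code_bases_def)
      moreover have "zs \<in> L (Mat.list_span zs)"
        using zs Mat.set_subset_list_span[OF V] by (auto simp: L_def code_bases_def)
      ultimately show "zs \<in> snd ` (SIGMA C:?R. L C)" by force
    qed
  qed
  moreover have "inj_on snd (SIGMA C:?R. L C)" using span by (auto simp: inj_on_def)
  ultimately have "card code_bases = card (SIGMA C:?R. L C)" by (simp add: card_image)
  moreover have "?R \<subseteq> Pow (carrier Mat)" using submodule.subset by (auto simp: rk_codes_eq)
  hence "finite ?R" using Mat.finite_vectors finite_subset by blast
  ultimately show ?thesis using cardX by (simp add: card_SigmaI)
qed

lemma unit_vec_nonzero: "n \<ge> 1 \<Longrightarrow> unit_vec 0 \<noteq> \<zero>\<^bsub>V\<^esub>"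
  by (auto simp: unit_vec_def vec_sp_simps fun_eq_iff intro!: exI[of _ 0])

text \<open>Up to nonzero scalars, the nonzero combinations of A and B are A and the B - c A. B
  stands at the head, which \<open>list_indpt\<close> requires to lie outside the span of A.\<close>

lemma code_bases_eq:
  assumes n: "n \<ge> 1"
  shows "code_bases = (\<lambda>(A, B). [B, A]) ` (SIGMA A:{A \<in> carrier Mat. nonsingular A}. pencil_free (app A) [] (carrier F))"
proof -
  have iff: "[B, A] \<in> code_bases \<longleftrightarrow> A \<in> carrier Mat \<and> nonsingular A \<and> B \<in> pencil_free (app A) [] (carrier F)" for A B
  proof
    assume P: "[B, A] \<in> code_bases"
    hence A: "A \<in> carrier Mat" "A \<noteq> \<zero>\<^bsub>Mat\<^esub>" and B: "B \<in> carrier Mat" "B \<notin> Mat.list_span [A]"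
      by (auto simp: code_bases_def)
    let ?S = "Mat.list_span [B, A]"
    have S: "submodule F ?S Mat" using A B by (intro Mat.list_span_submodule) auto
    have AB: "A \<in> ?S" "B \<in> ?S" using Mat.set_subset_list_span[of "[B, A]"] A B by auto
    have ns: "nonsingular D" if "D \<in> ?S" "D \<noteq> \<zero>\<^bsub>Mat\<^esub>" for D
      using P that by (simp only: code_bases_def mem_Collect_eq) blast
    have "v = \<zero>\<^bsub>V\<^esub>" if c: "c \<in> carrier F" and v: "v \<in> pencil_ker (app A) c B" for c v
    proof -
      have v: "v \<in> carrier V" "app B v = c \<odot>\<^bsub>V\<^esub> app A v" using v by (auto simp: pencil_ker_def)
      \<comment> \<open>B - c A is a nonzero element of the code, hence nonsingular, and v lies in
        its kernel.\<close>
      define D where "D = B \<oplus>\<^bsub>Mat\<^esub> (\<ominus> c) \<odot>\<^bsub>Mat\<^esub> A"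
      have "D \<in> ?S" unfolding D_def
        by (intro submodule.m_closed[OF S] submodule.smult_closed[OF S] AB a_inv_closed c)
      moreover have "D \<noteq> \<zero>\<^bsub>Mat\<^esub>"
      proof
        assume "D = \<zero>\<^bsub>Mat\<^esub>"
        hence "B = \<ominus>\<^bsub>Mat\<^esub> ((\<ominus> c) \<odot>\<^bsub>Mat\<^esub> A)"
          unfolding D_def using A B c by (intro Mat.M.minus_equality[symmetric]) auto
        also have "\<dots> = c \<odot>\<^bsub>Mat\<^esub> A \<oplus>\<^bsub>Mat\<^esub> \<zero>\<^bsub>Mat\<^esub>" using A c by (simp add: Mat.smult_l_minus)
        finally have "B = c \<odot>\<^bsub>Mat\<^esub> A \<oplus>\<^bsub>Mat\<^esub> \<zero>\<^bsub>Mat\<^esub>" .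
        moreover have "c \<odot>\<^bsub>Mat\<^esub> A \<oplus>\<^bsub>Mat\<^esub> \<zero>\<^bsub>Mat\<^esub> \<in> Mat.list_span [A]" using c by auto
        ultimately show False using B(2) by metis
      qed
      moreover have "app D v = \<zero>\<^bsub>V\<^esub>"
        unfolding D_def using A B c v
        by (simp add: mat_add_app mat_smult_app V.smult_l_minus V.M.r_neg)
      ultimately show "v = \<zero>\<^bsub>V\<^esub>" using ns v(1) by (auto simp: nonsingular_def)
    qed
    moreover have "\<zero>\<^bsub>V\<^esub> \<in> pencil_ker (app A) c B" if "c \<in> carrier F" for c
      using pencil_ker_submodule[OF app_module_hom[OF A(1)] that B(1)] by (rule submodule.zero_closed)
    ultimately show "A \<in> carrier Mat \<and> nonsingular A \<and> B \<in> pencil_free (app A) [] (carrier F)"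
      using A B ns[OF AB(1) A(2)] by (auto simp: pencil_free_def)
  next
    assume *: "A \<in> carrier Mat \<and> nonsingular A \<and> B \<in> pencil_free (app A) [] (carrier F)"
    hence A: "A \<in> carrier Mat" "nonsingular A" and B: "B \<in> carrier Mat"
      and noeig: "\<And>c v. c \<in> carrier F \<Longrightarrow> v \<in> carrier V \<Longrightarrow> app B v = c \<odot>\<^bsub>V\<^esub> app A v \<Longrightarrow> v = \<zero>\<^bsub>V\<^esub>"
      by (auto simp: pencil_free_def pencil_ker_def)
    have zero_app: "app \<zero>\<^bsub>Mat\<^esub> v = \<zero>\<^bsub>V\<^esub>" if "v \<in> carrier V" for v
      using mat_smult_app[of A \<zero> v] A that by simp
    note e = unit_vec_closed[of 0] unit_vec_nonzero[OF n]
    \<comment> \<open>Here n \<ge> 1 provides a nonzero vector; for n = 0 the zero matrix would be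
      nonsingular.\<close>
    have A0: "A \<noteq> \<zero>\<^bsub>Mat\<^esub>" using A(2) zero_app e unfolding nonsingular_def by blast
    have BA: "B \<notin> Mat.list_span [A]"
    proof
      assume "B \<in> Mat.list_span [A]"
      then obtain c where "c \<in> carrier F" "B = c \<odot>\<^bsub>Mat\<^esub> A" using A by auto
      hence "app B (unit_vec 0) = c \<odot>\<^bsub>V\<^esub> app A (unit_vec 0)" using mat_smult_app A e by auto
      thus False using noeig e \<open>c \<in> carrier F\<close> by blast
    qed
    have "nonsingular D" if D: "D \<in> Mat.list_span [B, A]" "D \<noteq> \<zero>\<^bsub>Mat\<^esub>" for D
      unfolding nonsingular_def
    proof (intro ballI impI)
      fix v assume v: "v \<in> carrier V" "app D v = \<zero>\<^bsub>V\<^esub>"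
      obtain a b where ab: "a \<in> carrier F" "b \<in> carrier F" "D = b \<odot>\<^bsub>Mat\<^esub> B \<oplus>\<^bsub>Mat\<^esub> a \<odot>\<^bsub>Mat\<^esub> A"
        using D(1) A B by auto
      have eq: "b \<odot>\<^bsub>V\<^esub> app B v \<oplus>\<^bsub>V\<^esub> a \<odot>\<^bsub>V\<^esub> app A v = \<zero>\<^bsub>V\<^esub>"
        using v ab A B by (simp add: mat_add_app mat_smult_app)
      have triv: "submodule F {\<zero>\<^bsub>V\<^esub>} V" by unfold_locales auto
      show "v = \<zero>\<^bsub>V\<^esub>"
      \<comment> \<open>If b = 0, then D is a nonzero multiple of A; otherwise division by b gives B
        v = -(a / b) A v.\<close>
      proof (cases "b = \<zero>")
        case True
        hence "a \<noteq> \<zero>" using D(2) ab A B by auto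
        moreover have "a \<odot>\<^bsub>V\<^esub> app A v = \<zero>\<^bsub>V\<^esub>" using eq True ab v A B by simp
        ultimately have "app A v = \<zero>\<^bsub>V\<^esub>" using V.smult_in_submodule_iff[OF triv, of "app A v" a] ab v A by simp
        thus ?thesis using A(2) v by (simp add: nonsingular_def)
      next
        case False
        hence b: "b \<in> Units F" using ab field_Units by simp
        define i where "i = inv b"
        have i: "i \<in> carrier F" "i \<otimes> b = \<one>" using b by (simp_all add: i_def)
        have "b \<odot>\<^bsub>V\<^esub> app B v = \<ominus>\<^bsub>V\<^esub> (a \<odot>\<^bsub>V\<^esub> app A v)"
          using eq ab v A B by (intro V.M.minus_equality[symmetric]) auto
        hence "i \<odot>\<^bsub>V\<^esub> (b \<odot>\<^bsub>V\<^esub> app B v) = i \<odot>\<^bsub>V\<^esub> ((\<ominus> a) \<odot>\<^bsub>V\<^esub> app A v)"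
          using ab v A by (simp add: V.smult_l_minus)
        hence "app B v = (i \<otimes> (\<ominus> a)) \<odot>\<^bsub>V\<^esub> app A v"
          using i ab v A B by (simp add: V.smult_assoc1[symmetric])
        thus ?thesis using noeig[of "i \<otimes> (\<ominus> a)" v] i ab v by simp
      qed
    qed
    thus "[B, A] \<in> code_bases" using A A0 B BA
      by (simp add: code_bases_def del: Mat.list_span.simps(2))
  qed
  have two: "\<exists>A B. zs = [B, A]" if "zs \<in> code_bases" for zs
    using that by (auto simp: code_bases_def length_Suc_conv numeral_2_eq_2)
  show ?thesis
  proof
    show "code_bases \<subseteq> (\<lambda>(A, B). [B, A]) ` (SIGMA A:{A \<in> carrier Mat. nonsingular A}. pencil_free (app A) [] (carrier F))"
    proof
      fix zs assume zs: "zs \<in> code_bases"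
      then obtain A B where "zs = [B, A]" using two by blast
      thus "zs \<in> (\<lambda>(A, B). [B, A]) ` (SIGMA A:{A \<in> carrier Mat. nonsingular A}. pencil_free (app A) [] (carrier F))"
        using zs iff[of B A] by force
    qed
  qed (use iff in auto)
qed

lemma card_code_bases_eq:
  assumes "n \<ge> 1"
  shows "real (card code_bases) = gl_card (real q) n * real (card no_eigenvalue)"
proof -
  let ?S = "SIGMA A:{A \<in> carrier Mat. nonsingular A}. pencil_free (app A) [] (carrier F)"
  have "card code_bases = card ?S"
    unfolding code_bases_eq[OF assms] by (rule card_image) (auto simp: inj_on_def)
  also have "\<dots> = (\<Sum>A | A \<in> carrier Mat \<and> nonsingular A. card no_eigenvalue)"
  proof (subst card_SigmaI)
    show "\<forall>A\<in>{A \<in> carrier Mat. nonsingular A}. finite (pencil_free (app A) [] (carrier F))"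
      using Mat.finite_vectors by (auto simp: pencil_free_def)
    show "(\<Sum>A | A \<in> carrier Mat \<and> nonsingular A. card (pencil_free (app A) [] (carrier F))) =
        (\<Sum>A | A \<in> carrier Mat \<and> nonsingular A. card no_eigenvalue)"
      by (rule sum.cong) (auto simp: card_pencil_free_app)
  qed (use Mat.finite_vectors in auto)
  finally show ?thesis using card_nonsingular by simp
qed

lemma card_rk_codes:
  assumes "n \<ge> 1"
  shows "real (card (rk_codes F n n 2 n)) * ((real q ^ 2 - 1) * (real q ^ 2 - real q)) =
    gl_card (real q) n * real (card no_eigenvalue)"
  using card_code_bases card_code_bases_eq[OF assms] by simp

end

section \<open>The density of two-dimensional codes of full rank\<close>

lemma finite_field_matrices_GF: "primepow q \<Longrightarrow> finite_field_matrices (GF q)"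
  using GF_finite_field[of q] by (simp add: finite_field_matrices_def finite_field_matrices_axioms_def)

lemma num_no_eigenvalue_eq:
  assumes "primepow q"
  shows "real (num_no_eigenvalue q n) =
    gl_card (real q) n * (\<Sum>k\<le>n. fps_nth (fps_ker (real q) ^ (q - 1)) k)"
proof -
  interpret finite_field_matrices "GF q" n by (rule finite_field_matrices_GF[OF assms])
  show ?thesis
    using card_no_eigenvalue unfolding no_eigenvalue_def num_no_eigenvalue_def GF_finite_field(3)[OF assms] .
qed

lemma delta_rk_eq:
  assumes "primepow q" "n \<ge> 2"
  shows "delta_rk q n n 2 n = gl_card (real q) n * real (num_no_eigenvalue q n) /
    ((real q ^ (n^2) - 1) * (real q ^ (n^2) - real q))"
proof -
  interpret finite_field_matrices "GF q" n by (rule finite_field_matrices_GF[OF assms(1)])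
  have q: "real q > 1" using q_gt_1 GF_finite_field(3)[OF assms(1)] by simp
  have codes: "real (card (rk_codes (GF q) n n 2 n)) * ((real q ^ 2 - 1) * (real q ^ 2 - real q)) =
      gl_card (real q) n * real (num_no_eigenvalue q n)"
    using card_rk_codes assms(2) unfolding no_eigenvalue_def num_no_eigenvalue_def GF_finite_field(3)[OF assms(1)] by simp
  have "real q ^ 2 > 1" by (rule one_less_power[OF q]) simp
  hence nz1: "real q ^ 2 - 1 \<noteq> 0" by linarith
  have "real q ^ 2 - real q = real q * (real q - 1)" by (simp add: power2_eq_square algebra_simps)
  hence nz2: "real q ^ 2 - real q \<noteq> 0" using q by simp
  \<comment> \<open>The denominators for k = 2 multiply to the number of ordered bases of a code,
    which is the factor in \<open>codes\<close>.\<close>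
  have "delta_rk q n n 2 n = real (card (rk_codes (GF q) n n 2 n)) /
      ((real q ^ (n^2) - 1) / (real q ^ 2 - 1) * ((real q ^ (n^2) - real q) / (real q ^ 2 - real q)))"
    by (simp add: delta_rk_def numeral_2_eq_2)
  also have "\<dots> = real (card (rk_codes (GF q) n n 2 n)) * ((real q ^ 2 - 1) * (real q ^ 2 - real q)) /
      ((real q ^ (n^2) - 1) * (real q ^ (n^2) - real q))"
    using nz1 nz2 by (simp add: divide_simps)
  finally show ?thesis unfolding codes .
qed

lemma delta_rk_eq_partial_sum:
  assumes "primepow q" "n \<ge> 2"
  shows "delta_rk q n n 2 n = (\<Sum>k\<le>n. fps_nth (fps_ker (real q) ^ (q - 1)) k) *
    (\<Prod>j<n. 1 - 1 / real q ^ Suc j)\<^sup>2 *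
    (1 / ((1 - 1 / real q ^ (n^2)) * (1 - real q / real q ^ (n^2))))"
proof -
  have q: "real q > 1" using primepow_gt_Suc_0[OF assms(1)] by simp
  show ?thesis
    using density_eq[OF q, where n = n and s = "\<Sum>k\<le>n. fps_nth (fps_ker (real q) ^ (q - 1)) k"]
    unfolding delta_rk_eq[OF assms] num_no_eigenvalue_eq[OF assms(1)] by (simp add: mult_ac)
qed

theorem theorem6p2:
  fixes q n :: nat
  assumes "primepow q" and "n \<ge> 2"
  shows "delta_rk q n n 2 n =
           real (num_no_eigenvalue q n) * (\<Prod>i<n. (real q ^ n - real q ^ i)) /
           ((real q ^ (n^2) - 1) * (real q ^ (n^2) - real q)) \<and>
         ((\<lambda>r. delta_rk r n n 2 n) \<longlongrightarrow> (\<Sum>i=0..n. (-1) ^ i / fact i))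
           (inf at_top (principal {r. primepow r})) \<and>
         (\<lambda>m. delta_rk q m m 2 m) \<longlonglongrightarrow>
           (\<Prod>i. (1 - 1 / real q ^ (i + 1)) ^ (q + 1))"
proof (intro conjI)
  show "delta_rk q n n 2 n =
           real (num_no_eigenvalue q n) * (\<Prod>i<n. (real q ^ n - real q ^ i)) /
           ((real q ^ (n^2) - 1) * (real q ^ (n^2) - real q))"
    using delta_rk_eq[OF assms] by (simp add: gl_card_def mult.commute)
next
  let ?F = "inf at_top (principal {r. primepow r})"
  let ?g = "\<lambda>r::nat. (\<Sum>k\<le>n. fps_nth (fps_ker (real r) ^ (r - 1)) k) *
    (\<Prod>j<n. 1 - 1 / real r ^ Suc j)\<^sup>2 *
    (1 / ((1 - 1 / real r ^ (n^2)) * (1 - real r / real r ^ (n^2))))"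
  \<comment> \<open>The explicit formula converges along all naturals, hence along the finer filter
    of prime powers, where it equals the density.\<close>
  have "(?g \<longlongrightarrow> (\<Sum>k\<le>n. (-1) ^ k / fact k)) ?F"
    by (rule tendsto_mono[OF inf_le1 density_limit_q[OF assms(2)]])
  moreover have "eventually (\<lambda>r. ?g r = delta_rk r n n 2 n) ?F"
    unfolding eventually_inf_principal using delta_rk_eq_partial_sum[OF _ assms(2)] by simp
  ultimately have "((\<lambda>r. delta_rk r n n 2 n) \<longlongrightarrow> (\<Sum>k\<le>n. (-1) ^ k / fact k)) ?F"
    by (rule Lim_transform_eventually)
  thus "((\<lambda>r. delta_rk r n n 2 n) \<longlongrightarrow> (\<Sum>i=0..n. (-1) ^ i / fact i)) ?F"
    by (simp add: atLeast0AtMost)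
next
  have q: "q > 1" using primepow_gt_Suc_0[OF assms(1)] by simp
  hence q': "real q > 1" by simp
  have "(\<lambda>m. (\<Sum>k\<le>m. fps_nth (fps_ker (real q) ^ (q - 1)) k) * (\<Prod>j<m. 1 - 1 / real q ^ Suc j)\<^sup>2 *
      (1 / ((1 - 1 / real q ^ (m^2)) * (1 - real q / real q ^ (m^2))))) \<longlonglongrightarrow> euler_prod (real q) ^ (q - 1 + 2)"
    by (rule density_limit_n[OF q'])
  moreover have "eventually (\<lambda>m. (\<Sum>k\<le>m. fps_nth (fps_ker (real q) ^ (q - 1)) k) *
      (\<Prod>j<m. 1 - 1 / real q ^ Suc j)\<^sup>2 *
      (1 / ((1 - 1 / real q ^ (m^2)) * (1 - real q / real q ^ (m^2)))) = delta_rk q m m 2 m) sequentially"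
    using eventually_ge_at_top[of 2]
    by eventually_elim (rule delta_rk_eq_partial_sum[OF assms(1), symmetric])
  ultimately have "(\<lambda>m. delta_rk q m m 2 m) \<longlonglongrightarrow> euler_prod (real q) ^ (q - 1 + 2)"
    by (rule Lim_transform_eventually)
  \<comment> \<open>The exponent q - 1 stems from the matrices without eigenvalue, the 2 from the
    squared order of the general linear group.\<close>
  moreover have "q - 1 + 2 = q + 1" using q by simp
  ultimately show "(\<lambda>m. delta_rk q m m 2 m) \<longlonglongrightarrow> (\<Prod>i. (1 - 1 / real q ^ (i + 1)) ^ (q + 1))"
    unfolding prodinf_power_euler_prod[OF q'] by simp
qed

end
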